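(* Let $P_1$ and $P_2$ be two punctured Preparata codes of the same length $n$. Then the minimal distance graphs of $P_1$ and $P_2$ are isomorphic if and only if $P_1$ and $P_2$ are isometric, i.e. there exists a map $I:P_1\to P_2$ with $d(I(x),I(y))=d(x,y)$ for all $x,y\in P_1$.
   Context: $E^n$ is the set of binary vectors of length $n$ with the Hamming distance $d$. A Preparata code is a binary code of length $2^m$ ($m\ge 4$ even) with minimum distance $6$ and maximum possible cardinality among binary codes of that length and minimum distance. A punctured Preparata code is obtained from a Preparata code by deleting one coordinate; it has length $n=2^m-1$ and minimum distance (code distance) $5$. The minimal distance graph of a code $C$ with code distance $d_C$ has the codewords of $C$ as vertices, two vertices being adjacent iff their Hamming distance equals $d_C$. *)

theory Defs
  imports Main
begin

definition binvecs :: "nat \<Rightarrow> bool list set" where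
  "binvecs n = {x. length x = n}"

definition hamming :: "bool list \<Rightarrow> bool list \<Rightarrow> nat" where
  "hamming x y = card {i. i < length x \<and> i < length y \<and> x ! i \<noteq> y ! i}"

definition code_distance :: "bool list set \<Rightarrow> nat" where
  "code_distance C = Min {hamming x y | x y. x \<in> C \<and> y \<in> C \<and> x \<noteq> y}"

definition is_code :: "nat \<Rightarrow> bool list set \<Rightarrow> bool" where
  "is_code n C \<longleftrightarrow> C \<subseteq> binvecs n"

definition has_min_dist :: "bool list set \<Rightarrow> nat \<Rightarrow> bool" where
  "has_min_dist C d \<longleftrightarrow> 2 \<le> card C \<and> code_distance C = d"

definition preparata_code :: "nat \<Rightarrow> bool list set \<Rightarrow> bool" where
  "preparata_code m C \<longleftrightarrow> 4 \<le> m \<and> even m \<and> is_code (2 ^ m) C \<and> has_min_dist C 6 \<and>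
     (\<forall>D. is_code (2 ^ m) D \<and> has_min_dist D 6 \<longrightarrow> card D \<le> card C)"

definition delete_coord :: "nat \<Rightarrow> bool list \<Rightarrow> bool list" where
  "delete_coord i x = take i x @ drop (Suc i) x"

definition punctured_preparata :: "nat \<Rightarrow> bool list set \<Rightarrow> bool" where
  "punctured_preparata n P \<longleftrightarrow>
     (\<exists>m C i. preparata_code m C \<and> i < 2 ^ m \<and> n = 2 ^ m - 1 \<and> P = delete_coord i ` C)"

definition md_adj :: "bool list set \<Rightarrow> bool list \<Rightarrow> bool list \<Rightarrow> bool" where
  "md_adj C x y \<longleftrightarrow> x \<in> C \<and> y \<in> C \<and> hamming x y = code_distance C"

definition md_graphs_isomorphic :: "bool list set \<Rightarrow> bool list set \<Rightarrow> bool" where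
  "md_graphs_isomorphic C1 C2 \<longleftrightarrow>
     (\<exists>f. bij_betw f C1 C2 \<and> (\<forall>x\<in>C1. \<forall>y\<in>C1. md_adj C1 x y \<longleftrightarrow> md_adj C2 (f x) (f y)))"

definition isometric :: "bool list set \<Rightarrow> bool list set \<Rightarrow> bool" where
  "isometric C1 C2 \<longleftrightarrow>
     (\<exists>I. (\<forall>x\<in>C1. I x \<in> C2) \<and> (\<forall>x\<in>C1. \<forall>y\<in>C1. hamming (I x) (I y) = hamming x y))"

end

theory Submission
  imports Defs "HOL-Algebra.Algebraic_Closure_Type" "HOL-Library.Z2"
begin

text \<open>
  Words are identified with their supports. By the Baker--van Lint--Wilson construction a Preparata
  code meets the Johnson bound, so around each codeword \<open>x\<close> of the punctured code of length \<open>n\<close> the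
  differences with its neighbours are 5-sets such that every pair of coordinates lies in exactly
  \<open>(n - 3) / 3\<close> of them. As two such blocks share at most two points, each pair lies in exactly one
  triple not covered by a block.

  Hence, if \<open>x\<close> and \<open>y\<close> are at distance \<open>i\<close> and \<open>p\<^sub>t\<close> counts the blocks at \<open>x\<close> meeting the difference
  of \<open>x\<close> and \<open>y\<close> in \<open>t\<close> points, \<open>p\<^sub>3 + 4 p\<^sub>4 + 10 p\<^sub>5\<close> lies between \<open>i (i - 1) (i - 3) / 6\<close> and
  \<open>i (i - 1) (i - 2) / 6\<close>. These are the neighbours of \<open>x\<close> at distance \<open>i - 1\<close>, \<open>i - 3\<close>, \<open>i - 5\<close> from
  \<open>y\<close>, so a map preserving all distances below \<open>i\<close> carries them over, and comparing the two bounds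
  shows that it cannot increase the distance \<open>i\<close> either.
\<close>

section \<open>Blocks of size five meeting in at most two points\<close>

definition setdist :: "'a set \<Rightarrow> 'a set \<Rightarrow> nat" where
  "setdist A B = card (sym_diff A B)"

lemma setdist_commute: "setdist A B = setdist B A"
  by (simp add: setdist_def Un_commute)

lemma setdist_triangle:
  assumes "finite A" "finite B" "finite C"
  shows "setdist A C \<le> setdist A B + setdist B C"
proof -
  have "card (sym_diff A C) \<le> card (sym_diff A B \<union> sym_diff B C)"
    using assms by (intro card_mono) auto
  also have "\<dots> \<le> card (sym_diff A B) + card (sym_diff B C)"
    by (rule card_Un_le)
  finally show ?thesis by (simp add: setdist_def)
qed

lemma card_sym_diff_Int:
  assumes "finite A" "finite B"
  shows "card (sym_diff A B) + 2 * card (A \<inter> B) = card A + card B"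
proof -
  have "card (sym_diff A B) = card (A - B) + card (B - A)"
    using assms by (intro card_Un_disjoint) auto
  moreover have "card A = card (A - B) + card (A \<inter> B)"
    using assms by (metis card_Int_Diff add.commute)
  moreover have "card B = card (B - A) + card (A \<inter> B)"
    using assms by (metis card_Int_Diff add.commute Int_commute)
  ultimately show ?thesis by simp
qed

lemma even_card_sym_diff:
  assumes "finite A" "finite B" "even (card A) = even (card B)"
  shows "even (card (sym_diff A B))"
  using card_sym_diff_Int[OF assms(1,2)] assms(3) by (metis dvd_triv_left even_add)

text \<open>The two copies of \<open>c\<close> cancel, so passing to difference sets at a codeword
  preserves distances.\<close>

lemma setdist_translate: "card (sym_diff (sym_diff c A) (sym_diff c B)) = setdist A B"
  unfolding setdist_def by (rule arg_cong[where f = card]) auto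

text \<open>Symmetric difference with \<open>c\<close> is an involution carrying the sphere about
  \<open>c\<close> to the \<open>k\<close>-subsets of \<open>V\<close>.\<close>

lemma card_sphere:
  assumes "finite V" "c \<subseteq> V"
  shows "card {v. v \<subseteq> V \<and> setdist c v = k} = card V choose k"
proof -
  have "bij_betw (\<lambda>v. sym_diff c v) {v. v \<subseteq> V \<and> setdist c v = k} {T. T \<subseteq> V \<and> card T = k}"
    using assms by (intro bij_betw_byWitness[where f' = "\<lambda>v. sym_diff c v"])
      (auto simp: setdist_def intro!: arg_cong[where f = card])
  thus ?thesis using assms by (simp add: bij_betw_same_card n_subsets)
qed

text \<open>Double counting of incidences \<open>T \<subseteq> B\<close>: the sets \<open>T\<close>
  below a given block are the \<open>k\<close>-subsets of \<open>B \<inter> S\<close>.\<close>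

lemma sum_subsets_in_blocks:
  fixes w :: "'a set \<Rightarrow> nat"
  assumes "finite S" "finite \<B>"
  shows "(\<Sum>T\<in>{T. T \<subseteq> S \<and> card T = k}. \<Sum>B\<in>{B\<in>\<B>. T \<subseteq> B}. w B)
    = (\<Sum>B\<in>\<B>. (card (B \<inter> S) choose k) * w B)"
proof -
  have fin: "finite {T. T \<subseteq> S \<and> card T = k}" using assms by simp
  have "(\<Sum>T\<in>{T. T \<subseteq> S \<and> card T = k}. \<Sum>B\<in>{B\<in>\<B>. T \<subseteq> B}. w B)
     = (\<Sum>B\<in>\<B>. \<Sum>T\<in>{T\<in>{T. T \<subseteq> S \<and> card T = k}. T \<subseteq> B}. w B)"
    by (rule sum.swap_restrict[OF fin assms(2)])
  also have "\<dots> = (\<Sum>B\<in>\<B>. (card (B \<inter> S) choose k) * w B)"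
  proof (intro sum.cong refl)
    fix B
    have "{T\<in>{T. T \<subseteq> S \<and> card T = k}. T \<subseteq> B} = {T. T \<subseteq> B \<inter> S \<and> card T = k}" by auto
    thus "(\<Sum>T\<in>{T\<in>{T. T \<subseteq> S \<and> card T = k}. T \<subseteq> B}. w B) = (card (B \<inter> S) choose k) * w B"
      using assms by (simp only: sum_constant n_subsets finite_Int simp_thms) simp
  qed
  finally show ?thesis .
qed

lemma two_times_choose_two: "2 * (n choose 2) = n * (n - 1)" for n :: nat
proof -
  have "even (n * (n - 1))" by (cases n) auto
  thus ?thesis unfolding choose_two by simp
qed

text \<open>A partial Steiner system: three points determine at most one block.\<close>

definition packing5 :: "'a set set \<Rightarrow> bool" where
  "packing5 \<B> \<longleftrightarrow> (\<forall>B\<in>\<B>. card B = 5) \<and> (\<forall>B\<in>\<B>. \<forall>B'\<in>\<B>. B \<noteq> B' \<longrightarrow> card (B \<inter> B') \<le> 2)"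

lemma packing5_finite: "packing5 \<B> \<Longrightarrow> B \<in> \<B> \<Longrightarrow> finite B"
  unfolding packing5_def by (metis card.infinite zero_neq_numeral)

text \<open>Two blocks through \<open>T\<close> meet exactly in \<open>T\<close>, so their remaining
  points are disjoint and the sum over blocks becomes the size of a union.\<close>

lemma packing5_pair_sum:
  assumes "packing5 \<B>" "finite \<B>" "finite S" "T \<subseteq> S" "card T = 2"
  shows "(\<Sum>B\<in>{B\<in>\<B>. T \<subseteq> B}. card (B \<inter> S) - 2) = card (S \<inter> (\<Union>B\<in>{B\<in>\<B>. T \<subseteq> B}. B - T))"
proof -
  have finT: "finite T" using assms(3,4) finite_subset by blast
  have "card (\<Union>B\<in>{B\<in>\<B>. T \<subseteq> B}. S \<inter> (B - T)) = (\<Sum>B\<in>{B\<in>\<B>. T \<subseteq> B}. card (S \<inter> (B - T)))"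
  proof (rule card_UN_disjoint)
    show "\<forall>B\<in>{B\<in>\<B>. T \<subseteq> B}. \<forall>B'\<in>{B\<in>\<B>. T \<subseteq> B}. B \<noteq> B' \<longrightarrow> (S \<inter> (B - T)) \<inter> (S \<inter> (B' - T)) = {}"
    proof (intro ballI impI)
      fix B B' assume B: "B \<in> {B\<in>\<B>. T \<subseteq> B}" "B' \<in> {B\<in>\<B>. T \<subseteq> B}" "B \<noteq> B'"
      have "T = B \<inter> B'"
        using B assms(1,5) packing5_finite[OF assms(1)]
        by (intro card_seteq) (auto simp: packing5_def)
      thus "(S \<inter> (B - T)) \<inter> (S \<inter> (B' - T)) = {}" by auto
    qed
  qed (use assms in auto)
  moreover have "card (S \<inter> (B - T)) = card (B \<inter> S) - 2" if "T \<subseteq> B" for B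
  proof -
    have "S \<inter> (B - T) = (B \<inter> S) - T" by auto
    thus ?thesis using that assms finT by (simp add: card_Diff_subset)
  qed
  moreover have "S \<inter> (\<Union>B\<in>{B\<in>\<B>. T \<subseteq> B}. B - T) = (\<Union>B\<in>{B\<in>\<B>. T \<subseteq> B}. S \<inter> (B - T))" by auto
  ultimately show ?thesis by simp
qed

lemma packing5_pair_sum_le:
  assumes "packing5 \<B>" "finite \<B>" "finite S" "T \<subseteq> S" "card T = 2"
  shows "(\<Sum>B\<in>{B\<in>\<B>. T \<subseteq> B}. card (B \<inter> S) - 2) \<le> card S - 2"
proof -
  have "card (S \<inter> (\<Union>B\<in>{B\<in>\<B>. T \<subseteq> B}. B - T)) \<le> card (S - T)"
    using assms by (intro card_mono) auto
  also have "\<dots> = card S - 2"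
    using assms finite_subset by (subst card_Diff_subset) auto
  finally show ?thesis using packing5_pair_sum[OF assms] by simp
qed

text \<open>Each block lies in \<open>S\<close> and contributes its three points outside
  \<open>T\<close>, which turns the sum into a pair degree.\<close>

lemma packing5_pair_card:
  assumes "packing5 \<B>" "\<B> \<subseteq> Pow S" "finite S" "T \<subseteq> S" "card T = 2"
  shows "(\<Sum>B\<in>{B\<in>\<B>. T \<subseteq> B}. card (B \<inter> S) - 2) = 3 * card {B\<in>\<B>. T \<subseteq> B}"
proof -
  have "card (B \<inter> S) = 5" if "B \<in> \<B>" for B
    using that assms by (auto simp: packing5_def Int_absorb2)
  hence "(\<Sum>B\<in>{B\<in>\<B>. T \<subseteq> B}. card (B \<inter> S) - 2) = (\<Sum>B\<in>{B\<in>\<B>. T \<subseteq> B}. 3)"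
    by (intro sum.cong) auto
  thus ?thesis by simp
qed

lemma packing5_pair_degree_le:
  assumes "packing5 \<B>" "\<B> \<subseteq> Pow S" "finite S" "T \<subseteq> S" "card T = 2"
  shows "3 * card {B\<in>\<B>. T \<subseteq> B} \<le> card S - 2"
  using packing5_pair_sum_le[of \<B> S T] packing5_pair_card[OF assms] assms
    finite_subset[of \<B> "Pow S"] by simp

lemma packing5_card_eq_pair_sum:
  assumes "packing5 \<B>" "\<B> \<subseteq> Pow S" "finite S"
  shows "10 * card \<B> = (\<Sum>T\<in>{T. T \<subseteq> S \<and> card T = 2}. card {B\<in>\<B>. T \<subseteq> B})"
proof -
  have "finite \<B>" using assms finite_subset[of \<B> "Pow S"] by simp
  hence "(\<Sum>T\<in>{T. T \<subseteq> S \<and> card T = 2}. \<Sum>B\<in>{B\<in>\<B>. T \<subseteq> B}. 1)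
    = (\<Sum>B\<in>\<B>. (card (B \<inter> S) choose 2) * 1)"
    using assms by (intro sum_subsets_in_blocks)
  also have "\<dots> = (\<Sum>B\<in>\<B>. 10)"
  proof (intro sum.cong refl)
    fix B assume "B \<in> \<B>"
    hence "card (B \<inter> S) = 5" using assms by (auto simp: packing5_def Int_absorb2)
    thus "(card (B \<inter> S) choose 2) * 1 = 10" by (simp add: choose_two)
  qed
  finally show ?thesis by simp
qed

text \<open>Fixing a pair, the remaining triples of its blocks are disjoint, so the weight
  \<open>(t choose 2) * (t - 2)\<close> counts, over pairs in \<open>S\<close>, the third points of \<open>S\<close> they cover.\<close>
lemma packing5_triples_upper:
  assumes "packing5 \<B>" "finite \<B>" "finite S"
  shows "(\<Sum>B\<in>\<B>. (card (B \<inter> S) choose 2) * (card (B \<inter> S) - 2)) \<le> (card S choose 2) * (card S - 2)"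
proof -
  have "(\<Sum>B\<in>\<B>. (card (B \<inter> S) choose 2) * (card (B \<inter> S) - 2))
     = (\<Sum>T\<in>{T. T \<subseteq> S \<and> card T = 2}. \<Sum>B\<in>{B\<in>\<B>. T \<subseteq> B}. card (B \<inter> S) - 2)"
    using assms by (intro sum_subsets_in_blocks[symmetric])
  also have "\<dots> \<le> (\<Sum>T\<in>{T. T \<subseteq> S \<and> card T = 2}. card S - 2)"
    using assms by (intro sum_mono packing5_pair_sum_le) auto
  finally show ?thesis using assms by (simp add: n_subsets)
qed

text \<open>The blocks through \<open>T\<close> cover \<open>card V - 3\<close> of the
  \<open>card V - 2\<close> other points. At most one point is missed, so each pair in
  \<open>S\<close> loses at most one third point.\<close>

lemma packing5_triples_lower:
  assumes "packing5 \<B>" "\<B> \<subseteq> Pow V" "finite V" "S \<subseteq> V"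
    and deg: "\<And>T. T \<subseteq> V \<Longrightarrow> card T = 2 \<Longrightarrow> 3 * card {B\<in>\<B>. T \<subseteq> B} = card V - 3"
  shows "(card S choose 2) * (card S - 3) \<le> (\<Sum>B\<in>\<B>. (card (B \<inter> S) choose 2) * (card (B \<inter> S) - 2))"
proof -
  have fin: "finite \<B>" "finite S"
    using assms finite_subset[of \<B> "Pow V"] finite_subset[of S V] by auto
  have "card S - 3 \<le> (\<Sum>B\<in>{B\<in>\<B>. T \<subseteq> B}. card (B \<inter> S) - 2)" if T: "T \<subseteq> S" "card T = 2" for T
  proof -
    define W where "W = (\<Union>B\<in>{B\<in>\<B>. T \<subseteq> B}. B - T)"
    have TV: "T \<subseteq> V" using T assms by auto
    have finT: "finite T" using T fin finite_subset by blast
    have WV: "W \<subseteq> V - T" unfolding W_def using assms by auto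
    have "card (V \<inter> W) = card V - 3"
      using packing5_pair_sum[OF assms(1) fin(1) assms(3) TV T(2)]
        packing5_pair_card[OF assms(1-3) TV T(2)] deg[OF TV T(2)] unfolding W_def by simp
    moreover have "V \<inter> W = W" using WV by auto
    ultimately have cW: "card W = card V - 3" by simp
    have "card ((V - T) - W) = card (V - T) - card W"
      using WV assms by (intro card_Diff_subset) (auto intro: finite_subset[of W V])
    also have "\<dots> = card V - 2 - (card V - 3)"
      using cW TV T finT by (simp add: card_Diff_subset)
    finally have one: "card ((V - T) - W) \<le> 1" by simp
    have "card S - 2 = card (S - T)" using T finT by (simp add: card_Diff_subset)
    also have "\<dots> \<le> card ((S \<inter> W) \<union> ((V - T) - W))"
      using assms fin by (intro card_mono) (auto intro: finite_subset)
    also have "\<dots> \<le> card (S \<inter> W) + 1"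
      using one card_Un_le[of "S \<inter> W" "(V - T) - W"] by linarith
    finally show ?thesis
      using packing5_pair_sum[OF assms(1) fin T] unfolding W_def by simp
  qed
  hence "(\<Sum>T\<in>{T. T \<subseteq> S \<and> card T = 2}. card S - 3)
     \<le> (\<Sum>T\<in>{T. T \<subseteq> S \<and> card T = 2}. \<Sum>B\<in>{B\<in>\<B>. T \<subseteq> B}. card (B \<inter> S) - 2)"
    by (intro sum_mono) auto
  also have "\<dots> = (\<Sum>B\<in>\<B>. (card (B \<inter> S) choose 2) * (card (B \<inter> S) - 2))"
    using fin by (intro sum_subsets_in_blocks)
  finally show ?thesis using fin by (simp add: n_subsets)
qed

section \<open>The blocks around a codeword\<close>

definition separated :: "nat \<Rightarrow> 'a set set \<Rightarrow> bool" where
  "separated d P \<longleftrightarrow> (\<forall>x\<in>P. \<forall>y\<in>P. x \<noteq> y \<longrightarrow> d \<le> setdist x y)"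

text \<open>After translating \<open>c\<close> to the empty set, these are the codewords of weight
  five.\<close>

definition blocks :: "'a set set \<Rightarrow> 'a set \<Rightarrow> 'a set set" where
  "blocks P c = (\<lambda>z. sym_diff c z) ` {z\<in>P. setdist c z = 5}"

text \<open>The symmetric difference of two blocks has the size of a codeword distance, hence at
  least 5 of the total 10, which leaves at most 5 for twice the intersection.\<close>

lemma packing5_blocks:
  assumes "P \<subseteq> Pow V" "finite V" "separated 5 P" "c \<in> P"
  shows "packing5 (blocks P c)"
  unfolding packing5_def
proof (intro conjI ballI impI)
  fix B assume "B \<in> blocks P c"
  thus "card B = 5" by (auto simp: blocks_def setdist_def)
next
  fix B B' assume B: "B \<in> blocks P c" "B' \<in> blocks P c" "B \<noteq> B'"
  then obtain z z' where z: "z \<in> P" "B = sym_diff c z" "card B = 5"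
     "z' \<in> P" "B' = sym_diff c z'" "card B' = 5" by (auto simp: blocks_def setdist_def)
  have "setdist z z' \<ge> 5" using z B assms by (auto simp: separated_def)
  hence "card (sym_diff B B') \<ge> 5" using setdist_translate[of c z z'] z by simp
  moreover have "card (sym_diff B B') + 2 * card (B \<inter> B') = 10"
    using z(3,6) card_sym_diff_Int[of B B'] card_ge_0_finite[of B] card_ge_0_finite[of B'] by simp
  ultimately show "card (B \<inter> B') \<le> 2" by linarith
qed

lemma blocks_subset: "P \<subseteq> Pow V \<Longrightarrow> c \<in> P \<Longrightarrow> blocks P c \<subseteq> Pow V"
  by (auto simp: blocks_def)

section \<open>Equality in the Johnson bound\<close>

text \<open>Separation 5 makes the radius-2 balls disjoint; the deep holes are the words outside all
  of them.\<close>

lemma card_deep_holes: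
  assumes "finite V" "P \<subseteq> Pow V" "separated 5 P"
  shows "2 ^ card V = card {v. v \<subseteq> V \<and> (\<forall>c\<in>P. 3 \<le> setdist c v)}
    + card P * (1 + card V + (card V choose 2))"
proof -
  define U where "U = {v. v \<subseteq> V \<and> (\<forall>c\<in>P. 3 \<le> setdist c v)}"
  define ball where "ball = (\<lambda>c. {v. v \<subseteq> V \<and> setdist c v \<le> 2})"
  have finP: "finite P" using assms finite_subset by blast
  have fin: "finite v" if "v \<subseteq> V" for v using that assms finite_subset by blast
  have cb: "card (ball c) = 1 + card V + (card V choose 2)" if "c \<in> P" for c
  proof -
    have "ball c = (\<Union>k\<in>{..2}. {v. v \<subseteq> V \<and> setdist c v = k})" by (auto simp: ball_def)
    also have "card \<dots> = (\<Sum>k\<le>2. card {v. v \<subseteq> V \<and> setdist c v = k})"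
      using assms by (intro card_UN_disjoint) auto
    also have "\<dots> = (\<Sum>k\<le>2. card V choose k)"
      using that assms by (intro sum.cong card_sphere) auto
    finally show ?thesis by (simp add: numeral_2_eq_2)
  qed
  have disj: "ball c \<inter> ball c' = {}" if "c \<in> P" "c' \<in> P" "c \<noteq> c'" for c c'
  proof (rule ccontr)
    assume "ball c \<inter> ball c' \<noteq> {}"
    then obtain v where v: "v \<subseteq> V" "setdist c v \<le> 2" "setdist c' v \<le> 2" by (auto simp: ball_def)
    moreover have "setdist c c' \<le> setdist c v + setdist v c'"
      using that assms v by (intro setdist_triangle fin) auto
    moreover have "5 \<le> setdist c c'" using that assms by (auto simp: separated_def)
    ultimately show False using setdist_commute[of v c'] by linarith
  qed
  have "Pow V = U \<union> (\<Union>c\<in>P. ball c)" by (auto simp: U_def ball_def)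
  hence "2 ^ card V = card (U \<union> (\<Union>c\<in>P. ball c))" using assms card_Pow[of V] by simp
  also have "\<dots> = card U + card (\<Union>c\<in>P. ball c)"
    using assms finP by (intro card_Un_disjoint) (auto simp: U_def ball_def)
  also have "card (\<Union>c\<in>P. ball c) = (\<Sum>c\<in>P. card (ball c))"
    using assms finP disj by (intro card_UN_disjoint) (auto simp: ball_def)
  also have "\<dots> = card P * (1 + card V + (card V choose 2))" using cb by simp
  finally show ?thesis unfolding U_def .
qed

text \<open>Seen from \<open>u\<close> these codewords are triples, and they are pairwise disjoint:
  a common point would bring their distance down to at most 4.\<close>

lemma card_codewords_at_distance_3:
  assumes "finite V" "P \<subseteq> Pow V" "separated 5 P" "u \<subseteq> V"
  shows "3 * card {c\<in>P. setdist c u = 3} \<le> card V"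
proof -
  have finP: "finite P" using assms finite_subset by blast
  have "card (\<Union>c\<in>{c\<in>P. setdist c u = 3}. sym_diff c u) = (\<Sum>c\<in>{c\<in>P. setdist c u = 3}. card (sym_diff c u))"
  proof (rule card_UN_disjoint)
    show "\<forall>c\<in>{c\<in>P. setdist c u = 3}. \<forall>c'\<in>{c\<in>P. setdist c u = 3}. c \<noteq> c' \<longrightarrow> sym_diff c u \<inter> sym_diff c' u = {}"
    proof (intro ballI impI)
      fix c c' assume c: "c \<in> {c\<in>P. setdist c u = 3}" "c' \<in> {c\<in>P. setdist c u = 3}" "c \<noteq> c'"
      have fin: "finite (sym_diff c u)" "finite (sym_diff c' u)"
        using c assms finite_subset[of c V] finite_subset[of c' V] finite_subset[of u V] by auto
      have "card (sym_diff (sym_diff c u) (sym_diff c' u)) = setdist c c'"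
        using setdist_translate[of u c c'] by (simp add: Un_commute)
      moreover have "5 \<le> setdist c c'" using c assms by (auto simp: separated_def)
      ultimately have "card (sym_diff c u \<inter> sym_diff c' u) = 0"
        using card_sym_diff_Int[OF fin] c by (simp add: setdist_def)
      thus "sym_diff c u \<inter> sym_diff c' u = {}" using fin by simp
    qed
  qed (use assms finP in \<open>auto intro: finite_subset[of _ V]\<close>)
  also have "\<dots> = 3 * card {c\<in>P. setdist c u = 3}" by (simp add: setdist_def)
  finally have "3 * card {c\<in>P. setdist c u = 3} = card (\<Union>c\<in>{c\<in>P. setdist c u = 3}. sym_diff c u)" ..
  also have "\<dots> \<le> card V" using assms by (intro card_mono) auto
  finally show ?thesis .
qed

text \<open>A word \<open>v\<close> at distance 3 from \<open>c\<close> that is no deep hole lies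
  within 2 of another codeword \<open>d\<close>. Then \<open>d\<close> is a neighbour of
  \<open>c\<close>, and the difference triple of \<open>c\<close> and \<open>v\<close> is one of the
  ten triples in its block.\<close>

lemma card_deep_holes_at_distance_3:
  assumes "finite V" "P \<subseteq> Pow V" "separated 5 P" "c \<in> P"
  shows "card V choose 3
    \<le> card {v. (v \<subseteq> V \<and> (\<forall>c\<in>P. 3 \<le> setdist c v)) \<and> setdist c v = 3} + 10 * card (blocks P c)"
proof -
  define N where "N = {v. (v \<subseteq> V \<and> (\<forall>c\<in>P. 3 \<le> setdist c v)) \<and> setdist c v = 3}"
  have finN: "finite N" using assms by (auto simp: N_def)
  have finb: "finite (blocks P c)"
    using blocks_subset[OF assms(2,4)] assms(1) by (auto intro: finite_subset)
  have fin: "finite v" if "v \<subseteq> V" for v using that assms finite_subset by blast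
  have cV: "c \<subseteq> V" using assms by auto
  have card5: "card B = 5" "finite B" if "B \<in> blocks P c" for B
    using that packing5_blocks[OF assms(2,1,3,4)] packing5_finite by (auto simp: packing5_def)
  define trip where "trip = (\<lambda>B. (\<lambda>T. sym_diff c T) ` {T. T \<subseteq> B \<and> card T = 3})"
  have "{v. v \<subseteq> V \<and> setdist c v = 3} \<subseteq> N \<union> (\<Union>B\<in>blocks P c. trip B)"
  proof safe
    fix v assume v: "v \<subseteq> V" "setdist c v = 3" "v \<notin> (\<Union>B\<in>blocks P c. trip B)"
    have "3 \<le> setdist d v" if d: "d \<in> P" for d
    proof (rule ccontr)
      assume less: "\<not> 3 \<le> setdist d v"
      have dV: "d \<subseteq> V" using d assms by auto
      have "d \<noteq> c" using less v by auto
      hence "5 \<le> setdist c d" using d assms by (auto simp: separated_def)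
      moreover have "setdist c d \<le> setdist c v + setdist v d"
        using cV dV v by (intro setdist_triangle fin)
      ultimately have *: "setdist c d = 5" "setdist v d = 2"
        using less v setdist_commute[of d v] by linarith+
      have B: "sym_diff c d \<in> blocks P c" using d * by (auto simp: blocks_def)
      \<comment> \<open>Sets of sizes 3 and 5 at distance 2 share three points, so the triple is
        contained in the block.\<close>
      have "card (sym_diff c v \<inter> sym_diff c d) = 3"
        using card_sym_diff_Int[of "sym_diff c v" "sym_diff c d"] setdist_translate[of c v d] * v
          fin[OF cV] fin[OF dV] fin[OF v(1)] by (simp add: setdist_def)
      hence "sym_diff c v \<inter> sym_diff c d = sym_diff c v"
        using v fin[OF cV] fin[OF v(1)] by (intro card_subset_eq) (auto simp: setdist_def)
      hence "sym_diff c v \<subseteq> sym_diff c d" by blast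
      moreover have "v = sym_diff c (sym_diff c v)" by auto
      ultimately have "v \<in> trip (sym_diff c d)" using v(2) unfolding trip_def setdist_def
        by (intro image_eqI[of _ _ "sym_diff c v"]) auto
      thus False using v B by blast
    qed
    thus "v \<in> N" using v by (auto simp: N_def)
  qed
  hence "card {v. v \<subseteq> V \<and> setdist c v = 3} \<le> card (N \<union> (\<Union>B\<in>blocks P c. trip B))"
    using finN finb card5 by (intro card_mono) (auto simp: trip_def)
  also have "\<dots> \<le> card N + card (\<Union>B\<in>blocks P c. trip B)" by (rule card_Un_le)
  also have "card (\<Union>B\<in>blocks P c. trip B) \<le> (\<Sum>B\<in>blocks P c. card (trip B))"
    using finb by (rule card_UN_le)
  also have "\<dots> \<le> (\<Sum>B\<in>blocks P c. 10)"
  proof (intro sum_mono)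
    fix B assume "B \<in> blocks P c"
    note B = card5[OF this]
    have "card (trip B) \<le> card {T. T \<subseteq> B \<and> card T = 3}"
      unfolding trip_def using B by (intro card_image_le) simp
    also have "\<dots> = 10" using B by (simp add: n_subsets) (simp add: numeral_eq_Suc)
    finally show "card (trip B) \<le> 10" .
  qed
  finally show ?thesis using card_sphere[OF assms(1) cV, of 3] unfolding N_def by simp
qed

text \<open>The Johnson bound counts pairs of a codeword \<open>c\<close> and a word \<open>u\<close> at distance 3 from it that lies
  outside all radius-2 balls. Each \<open>u\<close> has at most \<open>n/3\<close> such \<open>c\<close>, and each \<open>c\<close> has all triples
  except the ten in every block; a size meeting the bound leaves no slack in any pair degree.\<close>
theorem johnson_equality_design:
  assumes V: "finite V" "3 dvd card V" and P: "P \<subseteq> Pow V" "separated 5 P"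
    and big: "2 ^ (card V + 1) \<le> card P * (card V + 1)\<^sup>2"
    and c: "c \<in> P" and T: "T \<subseteq> V" "card T = 2"
  shows "3 * card {B\<in>blocks P c. T \<subseteq> B} = card V - 3"
proof -
  define n p m2 m3 where "n = card V" and "p = card P" and "m2 = card V choose 2" and "m3 = card V choose 3"
  define U where "U = {v. v \<subseteq> V \<and> (\<forall>c\<in>P. 3 \<le> setdist c v)}"
  define N where "N = (\<lambda>c. card {v\<in>U. setdist c v = 3})"
  define b where "b = (\<lambda>c. card (blocks P c))"
  define lam where "lam = (\<lambda>c T. card {B\<in>blocks P c. T \<subseteq> B})"
  define Ts where "Ts = {T. T \<subseteq> V \<and> card T = 2}"
  have finP: "finite P" using V P finite_subset by blast
  have finU: "finite U" using V by (auto simp: U_def)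
  have "2 \<le> n" using T V card_mono[of V T] by (simp add: n_def)
  hence n3: "3 \<le> n" using V(2) unfolding n_def by (auto elim!: dvdE)
  have lam: "3 * lam c T \<le> n - 3" if "c \<in> P" "T \<in> Ts" for c T
  proof -
    have "3 * lam c T \<le> n - 2"
      using packing5_pair_degree_le[OF packing5_blocks[OF P(1) V(1) P(2)] blocks_subset[OF P(1)]] that V
      by (auto simp: lam_def n_def Ts_def)
    \<comment> \<open>As \<open>3 dvd n\<close>, a multiple of three that is at most
      \<open>n - 2\<close> is at most \<open>n - 3\<close>.\<close>
    moreover obtain k where "n = 3 * k" using V(2) unfolding n_def by (elim dvdE)
    ultimately show ?thesis by presburger
  qed
  have b_eq: "10 * b c = (\<Sum>T\<in>Ts. lam c T)" if "c \<in> P" for c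
    unfolding b_def lam_def Ts_def
    by (rule packing5_card_eq_pair_sum[OF packing5_blocks[OF P(1) V(1) P(2) that] blocks_subset[OF P(1) that] V(1)])
  have cTs: "card Ts = m2" using V by (simp add: Ts_def m2_def n_subsets)
  have sumlam: "(\<Sum>T\<in>Ts. 3 * lam c T) = 30 * b c" if "c \<in> P" for c
    using b_eq[OF that] by (simp flip: sum_distrib_left)
  have b_le: "30 * b c \<le> m2 * (n - 3)" if "c \<in> P" for c
  proof -
    have "(\<Sum>T\<in>Ts. 3 * lam c T) \<le> (\<Sum>T\<in>Ts. n - 3)" using lam that by (intro sum_mono) auto
    thus ?thesis using sumlam[OF that] cTs by simp
  qed
  have e1: "2 ^ n = card U + p * (1 + n + m2)"
    using card_deep_holes[OF V(1) P] by (simp add: n_def p_def m2_def U_def)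
  have e2: "3 * (\<Sum>c\<in>P. N c) \<le> n * card U"
  proof -
    have "(\<Sum>c\<in>P. N c) = (\<Sum>u\<in>U. card {c\<in>P. setdist c u = 3})"
      using sum.swap_restrict[OF finP finU, of "\<lambda>_ _. 1::nat" "\<lambda>c u. setdist c u = 3"] by (simp add: N_def)
    hence "3 * (\<Sum>c\<in>P. N c) = (\<Sum>u\<in>U. 3 * card {c\<in>P. setdist c u = 3})" by (simp add: sum_distrib_left)
    also have "\<dots> \<le> (\<Sum>u\<in>U. n)"
      using card_codewords_at_distance_3[OF V(1) P] by (intro sum_mono) (auto simp: U_def n_def)
    finally show ?thesis by (simp add: mult.commute)
  qed
  have e3: "m3 \<le> N c + 10 * b c" if "c \<in> P" for c
    using card_deep_holes_at_distance_3[OF V(1) P that] by (simp add: m3_def N_def b_def U_def)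
  have "(\<Sum>c\<in>P. m3) \<le> (\<Sum>c\<in>P. N c + 10 * b c)" using e3 by (rule sum_mono)
  hence e4: "p * m3 \<le> (\<Sum>c\<in>P. N c) + 10 * (\<Sum>c\<in>P. b c)"
    by (simp add: sum.distrib sum_distrib_left p_def)
  have m2: "2 * m2 = n * (n - 1)"
    unfolding m2_def n_def by (rule two_times_choose_two)
  have m3: "3 * m3 = m2 * (n - 2)"
    using binomial_absorption[of 2 n] binomial_absorb_comp[of n 2] n3
    unfolding m3_def m2_def n_def[symmetric] by (simp add: numeral_3_eq_3 mult.commute Suc_diff_le)
  have e5: "2 * 2 ^ n \<le> p * (n + 1)\<^sup>2" using big by (simp add: n_def p_def)
  \<comment> \<open>The size hypothesis leaves at most \<open>p * (n - 1) / 2\<close> words outside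
    the balls; multiplying by \<open>n\<close> gives \<open>p * m2\<close>.\<close>
  have e6: "n * card U \<le> p * m2"
  proof -
    have "2 * card U + 2 * p * (1 + n) + p * (n * (n - 1)) \<le> p * (n + 1)\<^sup>2"
      unfolding m2[symmetric] using e1 e5 by (simp add: algebra_simps)
    also have "p * (n + 1)\<^sup>2 = 2 * p * (1 + n) + p * (n * (n - 1)) + p * (n - 1)"
      using n3 by (cases n) (simp_all add: algebra_simps power2_eq_square)
    finally have "2 * card U \<le> p * (n - 1)" by simp
    hence "n * (2 * card U) \<le> n * (p * (n - 1))" by (rule mult_le_mono2)
    also have "\<dots> = p * (2 * m2)" using m2 by simp
    finally show ?thesis by simp
  qed
  \<comment> \<open>By \<open>e2\<close> and \<open>e6\<close> the deep holes account for at most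
    \<open>p * m2\<close>, which turns the factor \<open>n - 2\<close> into
    \<open>n - 3\<close>.\<close>
  have e7: "p * (m2 * (n - 3)) \<le> 30 * (\<Sum>c\<in>P. b c)"
  proof -
    have "p * (m2 * (n - 2)) \<le> 3 * (\<Sum>c\<in>P. N c) + 30 * (\<Sum>c\<in>P. b c)"
      using e4 m3 by (simp flip: m3)
    moreover have "n - 2 = (n - 3) + 1" using n3 by simp
    ultimately show ?thesis using e2 e6 by (simp add: algebra_simps)
  qed
  \<comment> \<open>\<open>b_le\<close> is the reverse inequality. Equality of the sums forces
    equality termwise, first over codewords and then over pairs.\<close>
  have "(\<Sum>c\<in>P. 30 * b c) = (\<Sum>c\<in>P. m2 * (n - 3))"
    using e7 sum_mono[OF b_le, of P "\<lambda>x. x"] by (intro antisym) (auto simp: p_def sum_distrib_left)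
  hence "30 * b c = m2 * (n - 3)"
    using sum_mono_inv[of "\<lambda>c. 30 * b c" P "\<lambda>_. m2 * (n - 3)" c] b_le finP c by auto
  hence "(\<Sum>T\<in>Ts. 3 * lam c T) = (\<Sum>T\<in>Ts. n - 3)" using sumlam[OF c] cTs by simp
  hence "3 * lam c T = n - 3"
    using sum_mono_inv[of "\<lambda>T. 3 * lam c T" Ts "\<lambda>_. n - 3" T] lam c T V by (auto simp: Ts_def)
  thus ?thesis by (simp add: lam_def n_def)
qed

section \<open>Existence of codes of Preparata size\<close>

lemma CHAR_bit_alg_closure: "CHAR(bit alg_closure) = 2"
proof -
  have "CHAR(bit) = 2"
    by (rule CHAR_eqI) (auto elim: evenE, metis even_of_nat dvd_0_right)
  thus ?thesis by simp
qed

lemma poly_double_root_pderiv: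
  fixes p :: "'a::idom poly"
  assumes "[:-x, 1:]\<^sup>2 dvd p"
  shows "poly (pderiv p) x = 0"
proof -
  obtain r where "p = [:-x, 1:]\<^sup>2 * r" using assms by (elim dvdE)
  thus ?thesis by (simp add: pderiv_mult power2_eq_square mult.assoc del: mult_pCons_left mult_pCons_right)
qed

text \<open>The derivative of \<open>X ^ q - X\<close> is \<open>-1\<close>, since \<open>q\<close>
  vanishes in characteristic two. So there is no double root and the polynomial splits into
  \<open>q\<close> distinct factors.\<close>

lemma card_frobenius_fixed_points:
  fixes n :: nat
  assumes char: "CHAR('a::alg_closed_field) = 2" and "n > 0"
  shows "card {x::'a. x ^ (2 ^ n) = x} = 2 ^ n"
proof -
  define q :: nat where "q = 2 ^ n"
  have q: "q > 1" using \<open>n > 0\<close> unfolding q_def by (intro one_less_power) auto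
  define p :: "'a poly" where "p = monom 1 q - monom 1 1"
  have lead: "coeff p q = 1" using q by (simp add: p_def)
  have deg: "degree p = q"
    using lead q by (intro antisym le_degree degree_le) (auto simp: p_def)
  have "p \<noteq> 0" using lead by auto
  then obtain A where A: "size A = degree p" "p = smult (lead_coeff p) (\<Prod>x\<in>#A. [:-x, 1:])"
    using alg_closed_imp_factorization by blast
  hence A2: "p = (\<Prod>x\<in>#A. [:-x, 1:])" using lead deg by simp
  have "of_nat q = (0::'a)"
    using char \<open>n > 0\<close> by (simp add: of_nat_eq_0_iff_char_dvd q_def del: of_nat_power)
  hence pd: "pderiv p = - 1"
    by (simp add: p_def pderiv_diff pderiv_monom flip: one_poly_eq_simps)
  have cnt: "count A x = 1" if "x \<in># A" for x
  proof (rule ccontr)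
    assume "count A x \<noteq> 1"
    with that obtain B where "A = add_mset x B" "x \<in># B"
      by (metis add_mset_remove_trivial_If count_add_mset count_eq_zero_iff mset_add One_nat_def)
    then obtain B' where "A = add_mset x (add_mset x B')" by (metis mset_add)
    hence "[:-x, 1:]\<^sup>2 dvd p" unfolding A2 by (simp add: power2_eq_square mult.assoc del: mult_pCons_left mult_pCons_right)
    hence "poly (pderiv p) x = 0" by (rule poly_double_root_pderiv)
    thus False by (simp add: pd)
  qed
  have "set_mset A = {x. poly p x = 0}"
    unfolding A2 by (auto simp: poly_prod_mset prod_mset_zero_iff)
  also have "\<dots> = {x. x ^ q = x}" by (auto simp: p_def poly_monom)
  finally have "{x::'a. x ^ q = x} = set_mset A" ..
  moreover have "card (set_mset A) = size A"
    using cnt by (simp add: size_multiset_overloaded_eq)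
  ultimately show ?thesis using A deg by (simp add: q_def)
qed

lemma frobenius_fixed_add:
  fixes x y :: "'a::comm_semiring_1"
  assumes "CHAR('a) = 2" "x ^ (2 ^ n) = x" "y ^ (2 ^ n) = y"
  shows "(x + y) ^ (2 ^ n) = x + y"
  using assms freshmans_dream'[of "2^n" n x y] by auto

lemma frobenius_fixed_sum:
  fixes f :: "'b \<Rightarrow> 'a::comm_semiring_1"
  assumes "CHAR('a) = 2" "\<And>x. x \<in> A \<Longrightarrow> f x ^ (2 ^ n) = f x"
  shows "sum f A ^ (2 ^ n) = sum f A"
  using assms freshmans_dream_sum'[of "2^n" n f A] by (auto intro: sum.cong)

text \<open>A root would satisfy \<open>z\<^sup>4 = z\<close>, so the \<open>n\<close>-th Frobenius power, \<open>n\<close> odd,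
  would send it to \<open>z\<^sup>2 \<noteq> z\<close>.\<close>
lemma no_cube_roots_of_unity_odd_degree:
  fixes z :: "'a::field"
  assumes char: "CHAR('a) = 2" and "odd n" and fixed: "z ^ (2 ^ n) = z"
  shows "z\<^sup>2 + z + 1 \<noteq> 0"
proof
  assume z: "z\<^sup>2 + z + 1 = 0"
  obtain k where k: "n = 2 * k + 1" using \<open>odd n\<close> by (elim oddE)
  have "(z - 1) * (z\<^sup>2 + z + 1) = z ^ 3 - 1" by (simp add: algebra_simps power2_eq_square power3_eq_cube)
  hence "z ^ 3 = 1" using z by simp
  hence z4: "z ^ 4 = z" by (simp add: numeral_eq_Suc)
  have "z ^ (4 ^ k) = z" by (induction k) (simp_all add: power_mult z4)
  moreover have "(2::nat) ^ n = 4 ^ k * 2" by (simp add: k power_mult)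
  ultimately have "z ^ (2 ^ n) = z\<^sup>2" by (simp only: power_mult)
  hence "z\<^sup>2 = z" using fixed by simp
  hence "1 + of_nat 2 * z = 0" using z by (simp add: algebra_simps)
  moreover have "of_nat 2 = (0::'a)" using char by (metis of_nat_CHAR)
  ultimately show False by simp
qed

lemma char2_add_self:
  fixes x :: "'a::comm_ring_1"
  assumes "CHAR('a) = 2"
  shows "x + x = 0"
proof -
  have "of_nat 2 = (0::'a)" using assms by (metis of_nat_CHAR)
  thus ?thesis by (metis mult_2 mult_zero_left of_nat_numeral)
qed

lemma char2_add_eq_0_iff:
  fixes x y :: "'a::comm_ring_1"
  assumes "CHAR('a) = 2"
  shows "x + y = 0 \<longleftrightarrow> x = y"
  using char2_add_self[OF assms] by (metis add_left_cancel)

text \<open>The common part is counted twice on the right and cancels.\<close>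

lemma char2_sum_sym_diff:
  fixes f :: "'b \<Rightarrow> 'a::comm_ring_1"
  assumes "CHAR('a) = 2" "finite A" "finite B"
  shows "sum f (sym_diff A B) = sum f A + sum f B"
proof -
  have "sum f (sym_diff A B) = sum f (A - B) + sum f (B - A)"
    using assms by (intro sum.union_disjoint) auto
  moreover have "sum f A = sum f (A - B) + sum f (A \<inter> B)"
    using assms by (metis sum.Int_Diff add.commute)
  moreover have "sum f B = sum f (B - A) + sum f (A \<inter> B)"
    using assms by (metis sum.Int_Diff add.commute Int_commute)
  moreover have "sum f (A \<inter> B) + sum f (A \<inter> B) = 0" using assms by (intro char2_add_self)
  ultimately show ?thesis by (simp add: algebra_simps)
qed

text \<open>This is the distance bound of the 2-error-correcting BCH code.\<close>
lemma char2_power_sums_nonzero: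
  fixes A :: "'a::field set"
  assumes char: "CHAR('a) = 2" and "card A = 2 \<or> card A = 4" and 1: "\<Sum>A = 0"
  shows "(\<Sum>x\<in>A. x ^ 3) \<noteq> 0"
  using assms(2)
proof
  assume "card A = 2"
  then obtain p q where "A = {p, q}" "p \<noteq> q" by (auto simp: card_2_iff)
  thus ?thesis using 1 char2_add_eq_0_iff[OF char] by auto
next
  assume "card A = 4"
  then obtain p q r u where A: "A = {p, q, r, u}" "p \<noteq> q" "p \<noteq> r" "p \<noteq> u" "q \<noteq> r" "q \<noteq> u" "r \<noteq> u"
    by (auto simp: card_Suc_eq numeral_eq_Suc)
  have "(p + q + r) + u = 0" using 1 A by (simp add: add.assoc)
  hence u: "u = p + q + r" using char2_add_eq_0_iff[OF char] by metis
  have two: "y + y = 0" for y :: 'a by (rule char2_add_self[OF char])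
  have "(\<Sum>x\<in>A. x ^ 3) = p ^ 3 + q ^ 3 + r ^ 3 + (p + q + r) ^ 3"
    using A by (simp add: u add.assoc)
  \<comment> \<open>The expansion of a cube of three terms, arranged so that what vanishes in
    characteristic two stands behind the factor 2.\<close>
  also have "\<dots> = (p + q) * (q + r) * (p + r) + 2 * (p^3 + q^3 + r^3 + (p + q) * (q + r) * (p + r))"
    by (simp add: algebra_simps power3_eq_cube)
  also have "2 = (0::'a)" using two[of 1] by (simp only: one_add_one)
  finally have "(\<Sum>x\<in>A. x ^ 3) = (p + q) * (q + r) * (p + r)" by simp
  thus ?thesis using A char2_add_eq_0_iff[OF char] by simp
qed

text \<open>For \<open>A = {p, p + a}\<close> and \<open>B = {u, u + a}\<close> the equation says that
  \<open>(u + p + s) / a\<close> is a primitive cube root of unity.\<close>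
lemma preparata_small_difference:
  fixes A B :: "'a::field set"
  assumes char: "CHAR('a) = 2" and "odd t"
    and AB: "A \<subseteq> {x. x ^ (2 ^ t) = x}" "B \<subseteq> {x. x ^ (2 ^ t) = x}" and s: "s ^ (2 ^ t) = s"
    and fin: "finite A" "finite B" and ev: "even (card A)" "even (card B)" and small: "card A + card B < 6"
    and eq1: "\<Sum>A = \<Sum>B"
    and eq3: "(\<Sum>x\<in>A. x ^ 3) + (\<Sum>x\<in>B. x ^ 3) = s\<^sup>2 * \<Sum>A + s * (\<Sum>A)\<^sup>2 + (\<Sum>A) ^ 3"
  shows "A = {} \<and> B = {}"
proof -
  have two: "y + y = 0" for y :: 'a by (rule char2_add_self[OF char])
  have "card A \<in> {0,1,2,3,4,5}" "card B \<in> {0,1,2,3,4,5}" using small by auto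
  hence "card A = 0 \<and> card B = 0 \<or> card A = 0 \<and> (card B = 2 \<or> card B = 4) \<or>
     card B = 0 \<and> (card A = 2 \<or> card A = 4) \<or> card A = 2 \<and> card B = 2"
    using ev small by auto
  then consider "card A = 0" "card B = 0" | "card A = 0" "card B = 2 \<or> card B = 4"
    | "card B = 0" "card A = 2 \<or> card A = 4" | "card A = 2" "card B = 2" by argo
  thus ?thesis
  proof cases
    case 1
    thus ?thesis using fin by simp
  next
    \<comment> \<open>With \<open>A\<close> empty the right-hand side of \<open>eq3\<close> is zero,
      so both power sums of \<open>B\<close> would vanish.\<close>
    case 2
    hence "A = {}" using fin by simp
    thus ?thesis using char2_power_sums_nonzero[OF char 2(2)] eq1 eq3 by simp
  next
    case 3
    hence "B = {}" using fin by simp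
    thus ?thesis using char2_power_sums_nonzero[OF char 3(2)] eq1 eq3 by simp
  next
    case 4
    then obtain p q u v where A: "A = {p, q}" "p \<noteq> q" and B: "B = {u, v}" "u \<noteq> v"
      by (auto simp: card_2_iff)
    define a where "a = p + q"
    have a: "a \<noteq> 0" using A char2_add_eq_0_iff[OF char] by (simp add: a_def)
    have sums: "\<Sum>A = a" "\<Sum>B = u + v" using A B by (auto simp: a_def)
    have q: "q = p + a" by (simp add: a_def add.assoc[symmetric] two)
    have v: "v = u + a" using eq1 sums by (metis add.assoc add.left_neutral two)
    \<comment> \<open>Up to multiples of two the cubic equation depends on \<open>u\<close>,
      \<open>p\<close> and \<open>s\<close> only through this sum.\<close>
    define w where "w = u + p + s"
    have "(\<Sum>x\<in>A. x ^ 3) + (\<Sum>x\<in>B. x ^ 3) = p^3 + (p+a)^3 + u^3 + (u+a)^3"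
      using A B q v by simp
    with eq3 have "p^3 + (p+a)^3 + u^3 + (u+a)^3 + (s\<^sup>2 * a + s * a\<^sup>2 + a ^ 3) = 0"
      unfolding sums by (simp add: two)
    moreover have "p^3 + (p+a)^3 + u^3 + (u+a)^3 + (s\<^sup>2 * a + s * a\<^sup>2 + a ^ 3)
       = a * (w\<^sup>2 + w * a + a\<^sup>2) + 2 * (p^3 + u^3 + a^3 + a*p\<^sup>2 + a\<^sup>2*p + a*u\<^sup>2 + a\<^sup>2 * u - a * (u*p + u*s + p*s))"
      by (simp add: w_def algebra_simps power2_eq_square power3_eq_cube)
    moreover have "(2::'a) = 0" using two[of 1] by (simp only: one_add_one)
    ultimately have "a * (w\<^sup>2 + w * a + a\<^sup>2) = 0" by simp
    hence "w\<^sup>2 + w * a + a\<^sup>2 = 0" using a by simp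
    hence "(w / a)\<^sup>2 + w / a + 1 = 0" using a by (simp add: field_simps power2_eq_square)
    moreover have "w ^ (2 ^ t) = w" "a ^ (2 ^ t) = a"
      unfolding w_def a_def using AB A B s by (auto intro!: frobenius_fixed_add char)
    hence "(w / a) ^ (2 ^ t) = w / a" by (simp add: power_divide)
    ultimately show ?thesis using no_cube_roots_of_unity_odd_degree[OF char \<open>odd t\<close>] by blast
  qed
qed

section \<open>Averaging over syndromes, and words as pairs of field subsets\<close>

lemma pigeonhole_average:
  assumes "finite A" "finite R" "f ` A \<subseteq> R" "R \<noteq> {}"
  shows "\<exists>r. card A \<le> card R * card {a\<in>A. f a = r}"
proof (rule ccontr)
  assume *: "\<nexists>r. card A \<le> card R * card {a\<in>A. f a = r}"
  have "card R * card A = card R * (\<Sum>r\<in>R. card {a\<in>A. f a = r})"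
    using sum.group[OF assms(1-3), of "\<lambda>_. 1::nat"] by simp
  also have "\<dots> = (\<Sum>r\<in>R. card R * card {a\<in>A. f a = r})" by (rule sum_distrib_left)
  also have "\<dots> < (\<Sum>r\<in>R. card A)"
    using * assms by (intro sum_strict_mono) (auto simp: not_le)
  finally show False by simp
qed

lemma card_eq_slices:
  fixes S :: "('a \<times> bool) set"
  assumes "finite S"
  shows "card S = card {x. (x, False) \<in> S} + card {x. (x, True) \<in> S}"
proof -
  have "S = (\<lambda>x. (x, False)) ` {x. (x, False) \<in> S} \<union> (\<lambda>x. (x, True)) ` {x. (x, True) \<in> S}"
    (is "_ = ?A \<union> ?B") by (auto simp: image_iff) (metis (full_types))
  moreover have "card (?A \<union> ?B) = card ?A + card ?B"
    using assms calculation by (intro card_Un_disjoint) (auto intro: finite_subset[of _ S])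
  ultimately show ?thesis by (simp add: card_image inj_on_def)
qed

lemma finite_slice:
  assumes "finite S" shows "finite {x. (x, b) \<in> S}"
  using finite_vimageI[OF assms, of "\<lambda>x. (x, b)"] by (simp add: vimage_def inj_on_def)

text \<open>The syndrome equations of Baker, van Lint and Wilson. All their fibres have
  distance at least 6, so averaging gives one of the required size.\<close>
lemma separated_6_code_exists:
  fixes t :: nat
  assumes "odd t"
  shows "\<exists>(V :: (bit alg_closure \<times> bool) set) P. finite V \<and> card V = 2 ^ (t + 1) \<and> P \<subseteq> Pow V \<and>
    separated 6 P \<and> 2 ^ card V \<le> card P * (card V)\<^sup>2"
proof -
  \<comment> \<open>The field of order \<open>2 ^ t\<close>, cut out as the fixed points of a
    Frobenius power.\<close>
  define F where "F = {x :: bit alg_closure. x ^ (2 ^ t) = x}"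
  note char = CHAR_bit_alg_closure
  have "t > 0" using \<open>odd t\<close> by (cases t) auto
  hence cF: "card F = 2 ^ t"
    unfolding F_def by (intro card_frobenius_fixed_points char)
  have finF: "finite F" using cF by (intro card_ge_0_finite) simp
  define sl :: "bool \<Rightarrow> (bit alg_closure \<times> bool) set \<Rightarrow> bit alg_closure set"
    where "sl = (\<lambda>b S. {x. (x, b) \<in> S})"
  define V where "V = F \<times> (UNIV :: bool set)"
  have finV: "finite V" using finF by (simp add: V_def)
  have cV: "card V = 2 ^ (t + 1)" by (simp add: V_def cF card_cartesian_product)
  define cub where "cub = (\<lambda>A :: bit alg_closure set. \<Sum>x\<in>A. x ^ 3)"
  define syn where "syn = (\<lambda>S. ((even (card (sl False S)), even (card (sl True S))),
    (\<Sum>(sl False S) + \<Sum>(sl True S), cub (sl False S) + (\<Sum>(sl False S)) ^ 3 + cub (sl True S))))"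
  have XF: "sl b S \<subseteq> F" if "S \<subseteq> V" for b S using that by (auto simp: sl_def V_def)
  have sumF: "\<Sum>A \<in> F" if "A \<subseteq> F" for A
    using that unfolding F_def by (auto intro!: frobenius_fixed_sum char)
  have powF: "x ^ k \<in> F" if "x \<in> F" for x k
    using that unfolding F_def mem_Collect_eq by (metis mult.commute power_mult)
  have cubF: "cub A \<in> F" if "A \<subseteq> F" for A
    using that powF unfolding F_def cub_def by (auto intro!: frobenius_fixed_sum char)
  have addF: "x + y \<in> F" if "x \<in> F" "y \<in> F" for x y
    using that unfolding F_def by (auto intro!: frobenius_fixed_add char)
  have syn: "syn ` Pow V \<subseteq> (UNIV \<times> UNIV) \<times> (F \<times> F)"
    unfolding syn_def using XF by (auto intro!: addF sumF powF cubF)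
  have "F \<noteq> {}" using cF by auto
  then obtain r where r: "card (Pow V) \<le> card ((UNIV \<times> UNIV :: (bool \<times> bool) set) \<times> (F \<times> F)) * card {S\<in>Pow V. syn S = r}"
    using pigeonhole_average[OF _ _ syn] finV finF by auto
  define P where "P = {S\<in>Pow V. syn S = r}"
  \<comment> \<open>Four parity patterns and \<open>q * q\<close> field pairs, with
    \<open>q = 2 ^ t\<close>, give \<open>(2 * q)\<^sup>2\<close> syndromes, exactly the factor
    allowed by the size claim.\<close>
  have "card ((UNIV \<times> UNIV :: (bool \<times> bool) set) \<times> (F \<times> F)) = (card V)\<^sup>2"
    by (simp add: card_cartesian_product cF cV power2_eq_square del: UNIV_Times_UNIV)
  hence big: "2 ^ card V \<le> card P * (card V)\<^sup>2"
    using r finV by (simp add: P_def card_Pow mult.commute)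
  have "separated 6 P" unfolding separated_def
  proof (intro ballI impI)
    fix S S' assume S: "S \<in> P" "S' \<in> P" "S \<noteq> S'"
    have SV: "S \<subseteq> V" "S' \<subseteq> V" and syneq: "syn S = syn S'" using S by (auto simp: P_def)
    have finS: "finite S" "finite S'" using SV finV finite_subset by auto
    have finX: "finite (sl b S)" "finite (sl b S')" for b using finS by (auto simp: sl_def finite_slice)
    define A B where "A = sym_diff (sl False S) (sl False S')" and "B = sym_diff (sl True S) (sl True S')"
    define s where "s = \<Sum>(sl False S)"
    have slice: "sl b (sym_diff S S') = sym_diff (sl b S) (sl b S')" for b by (auto simp: sl_def)
    have dist: "setdist S S' = card A + card B"
      using card_eq_slices[of "sym_diff S S'"] finS slice[of False] slice[of True]
      by (simp add: setdist_def A_def B_def sl_def)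
    have sumA: "\<Sum>A = s + \<Sum>(sl False S')" "\<Sum>B = \<Sum>(sl True S) + \<Sum>(sl True S')"
      unfolding A_def B_def s_def by (auto intro!: char2_sum_sym_diff char finX)
    have cubA: "cub A = cub (sl False S) + cub (sl False S')" "cub B = cub (sl True S) + cub (sl True S')"
      unfolding A_def B_def cub_def by (auto intro!: char2_sum_sym_diff char finX)
    have two: "y + y = 0" for y :: "bit alg_closure" by (rule char2_add_self[OF char])
    have "\<Sum>A + \<Sum>B = (s + \<Sum>(sl True S)) + (\<Sum>(sl False S') + \<Sum>(sl True S'))"
      unfolding sumA by (simp add: algebra_simps)
    also have "\<dots> = 0" using syneq by (simp add: syn_def s_def two)
    finally have eq1: "\<Sum>A = \<Sum>B" using char2_add_eq_0_iff[OF char] by blast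
    \<comment> \<open>Expressing the sum over \<open>S'\<close> through \<open>s\<close> and
      \<open>\<Sum>A\<close> leaves \<open>s ^ 3 + (s + \<Sum>A) ^ 3\<close>, which modulo 2 is the
      right-hand side in \<open>preparata_small_difference\<close>.\<close>
    have s': "\<Sum>(sl False S') = s + \<Sum>A" unfolding sumA by (simp add: add.assoc[symmetric] two)
    have "cub A + cub B + (s ^ 3 + (s + \<Sum>A) ^ 3) =
      (cub (sl False S) + s ^ 3 + cub (sl True S)) + (cub (sl False S') + (s + \<Sum>A) ^ 3 + cub (sl True S'))"
      unfolding cubA by (simp add: algebra_simps)
    also have "\<dots> = 0" using syneq unfolding s'[symmetric] by (simp add: syn_def s_def two del: mult_2)
    finally have "cub A + cub B = s ^ 3 + (s + \<Sum>A) ^ 3" using char2_add_eq_0_iff[OF char] by blast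
    also have "\<dots> = s\<^sup>2 * \<Sum>A + s * (\<Sum>A)\<^sup>2 + (\<Sum>A) ^ 3 + 2 * (s ^ 3 + s\<^sup>2 * \<Sum>A + s * (\<Sum>A)\<^sup>2)"
      by (simp add: algebra_simps power2_eq_square power3_eq_cube)
    also have "2 = (0 :: bit alg_closure)" using two[of 1] by (simp only: one_add_one)
    finally have eq3: "cub A + cub B = s\<^sup>2 * \<Sum>A + s * (\<Sum>A)\<^sup>2 + (\<Sum>A) ^ 3" by simp
    have evA: "even (card A)" and evB: "even (card B)"
      using syneq unfolding A_def B_def syn_def by (auto intro!: even_card_sym_diff finX)
    have AF: "A \<subseteq> F" "B \<subseteq> F" "s \<in> F" using XF SV by (auto simp: A_def B_def s_def intro: sumF)
    show "6 \<le> setdist S S'"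
    proof (rule ccontr)
      assume "\<not> 6 \<le> setdist S S'"
      hence "A = {} \<and> B = {}"
        using AF finX eq1 eq3 evA evB dist
        by (intro preparata_small_difference[OF char \<open>odd t\<close>, of A B s])
           (auto simp: F_def cub_def A_def B_def)
      hence "setdist S S' = 0" using dist by simp
      thus False using S(3) finS by (auto simp: setdist_def)
    qed
  qed
  moreover have "P \<subseteq> Pow V" by (auto simp: P_def)
  ultimately show ?thesis using finV cV big by (intro exI[of _ V] exI[of _ P] conjI)
qed

section \<open>Preservation of distances\<close>

text \<open>What survives of equality in the Johnson bound: around every codeword each pair lies in
  \<open>(n - 3) / 3\<close> blocks. The distance argument rests on this alone, not on
  optimality.\<close>

definition pair_design_code :: "'a set \<Rightarrow> 'a set set \<Rightarrow> bool" where
  "pair_design_code V P \<longleftrightarrow> finite V \<and> P \<subseteq> Pow V \<and> separated 5 P \<and>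
     (\<forall>c\<in>P. \<forall>T. T \<subseteq> V \<longrightarrow> card T = 2 \<longrightarrow> 3 * card {B\<in>blocks P c. T \<subseteq> B} = card V - 3)"

definition nbrs :: "'a set set \<Rightarrow> 'a set \<Rightarrow> 'a set \<Rightarrow> nat \<Rightarrow> 'a set set" where
  "nbrs P x y j = {z\<in>P. setdist x z = 5 \<and> setdist y z = j}"

context
  fixes V :: "'a set" and P x y
  assumes P: "pair_design_code V P" and xy: "x \<in> P" "y \<in> P"
begin

private lemma finV: "finite V" and PV: "P \<subseteq> Pow V" and sep: "separated 5 P" and finP: "finite P"
  using P finite_subset[of P "Pow V"] by (auto simp: pair_design_code_def)

private lemma finite_codeword: "z \<in> P \<Longrightarrow> finite z"
  using PV finV finite_subset by blast

text \<open>Seen from \<open>x\<close>, the distance from \<open>y\<close> to a neighbour is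
  governed by how many points its block shares with the difference of \<open>x\<close> and
  \<open>y\<close>.\<close>

lemma setdist_via_neighbour:
  assumes "z \<in> P" "setdist x z = 5"
  shows "setdist y z + 2 * card (sym_diff x z \<inter> sym_diff x y) = setdist x y + 5"
  using card_sym_diff_Int[of "sym_diff x z" "sym_diff x y"] setdist_translate[of x z y]
    assms finite_codeword[OF xy(1)] finite_codeword[OF xy(2)] finite_codeword[OF assms(1)] setdist_commute[of y z]
  by (simp add: setdist_def)

text \<open>These constraints make neighbour counts vanish in \<open>distance_step\<close>; the last
  one holds because no two codewords are at distance 1 to 4.\<close>

lemma nbrs_range:
  assumes "z \<in> nbrs P x y j"
  shows "setdist x y \<le> j + 5" "even (setdist x y + 5 + j)" "j = 0 \<or> 5 \<le> j"
proof -
  have z: "z \<in> P" "setdist x z = 5" "setdist y z = j" using assms by (auto simp: nbrs_def)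
  have fin: "finite x" "finite y" "finite z" using z xy finite_codeword by auto
  show "setdist x y \<le> j + 5"
    using setdist_triangle[OF fin(1,3,2)] setdist_commute[of y z] z by simp
  have "setdist x y + 5 + j = 2 * j + 2 * card (sym_diff x z \<inter> sym_diff x y)"
    using setdist_via_neighbour[OF z(1,2)] z(3) by simp
  thus "even (setdist x y + 5 + j)" by simp
  show "j = 0 \<or> 5 \<le> j"
    using sep z xy by (cases "y = z") (auto simp: separated_def setdist_def)
qed

text \<open>A block sharing \<open>t\<close> points with the difference belongs to a neighbour at
  distance \<open>i + 5 - 2 * t\<close> from \<open>y\<close>, where \<open>i = setdist x y\<close>.
  Its weight is zero for \<open>t \<le> 2\<close> and 3, 12, 30 for \<open>t\<close> equal to 3, 4,
  5.\<close>

lemma nbrs_triple_weight: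
  assumes "6 \<le> setdist x y"
  shows "(\<Sum>B\<in>blocks P x. (card (B \<inter> sym_diff x y) choose 2) * (card (B \<inter> sym_diff x y) - 2))
    = 3 * card (nbrs P x y (setdist x y - 1)) + 12 * card (nbrs P x y (setdist x y - 3))
      + 30 * card (nbrs P x y (setdist x y - 5))"
proof -
  define i where "i = setdist x y"
  define Z where "Z = {z\<in>P. setdist x z = 5}"
  define g :: "nat \<Rightarrow> nat" where "g = (\<lambda>t. (t choose 2) * (t - 2))"
  have finZ: "finite Z" using finP by (simp add: Z_def)
  have inj: "inj_on (\<lambda>z. sym_diff x z) Z" by (rule inj_onI) auto
  have card_nbrs: "card (nbrs P x y j) = (\<Sum>z\<in>Z. of_bool (setdist y z = j))" for j
  proof -
    have "nbrs P x y j = Z \<inter> {z. setdist y z = j}" by (auto simp: nbrs_def Z_def)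
    thus ?thesis using finZ by (simp add: of_bool_def sum.If_cases)
  qed
  have "(\<Sum>B\<in>blocks P x. g (card (B \<inter> sym_diff x y))) = (\<Sum>z\<in>Z. g (card (sym_diff x z \<inter> sym_diff x y)))"
    unfolding blocks_def Z_def[symmetric] using inj by (subst sum.reindex) (auto simp: o_def)
  also have "\<dots> = (\<Sum>z\<in>Z. 3 * of_bool (setdist y z = i - 1) + 12 * of_bool (setdist y z = i - 3)
      + 30 * of_bool (setdist y z = i - 5))"
  proof (intro sum.cong refl)
    fix z assume "z \<in> Z"
    hence z: "z \<in> P" "setdist x z = 5" by (auto simp: Z_def)
    define t where "t = card (sym_diff x z \<inter> sym_diff x y)"
    have eq: "setdist y z + 2 * t = i + 5"
      using setdist_via_neighbour[OF z] by (simp add: t_def i_def)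
    have "t \<le> card (sym_diff x z)"
      unfolding t_def using finite_codeword[OF xy(1)] finite_codeword[OF z(1)] by (intro card_mono) auto
    hence "t \<le> 5" using z by (simp add: setdist_def)
    hence "t \<in> {0,1,2,3,4,5}" by auto
    thus "g t = 3 * of_bool (setdist y z = i - 1) + 12 * of_bool (setdist y z = i - 3)
      + 30 * of_bool (setdist y z = i - 5)"
      using eq assms unfolding g_def i_def[symmetric] by (auto simp: choose_two)
  qed
  also have "\<dots> = 3 * card (nbrs P x y (i - 1)) + 12 * card (nbrs P x y (i - 3)) + 30 * card (nbrs P x y (i - 5))"
    unfolding card_nbrs by (simp add: sum.distrib sum_distrib_left)
  finally show ?thesis by (simp add: g_def i_def)
qed

lemma nbrs_lower:
  assumes "6 \<le> setdist x y"
  shows "(setdist x y choose 2) * (setdist x y - 3)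
    \<le> 3 * card (nbrs P x y (setdist x y - 1)) + 12 * card (nbrs P x y (setdist x y - 3))
      + 30 * card (nbrs P x y (setdist x y - 5))"
proof -
  have "sym_diff x y \<subseteq> V" using xy PV by auto
  hence "(card (sym_diff x y) choose 2) * (card (sym_diff x y) - 3) \<le>
    (\<Sum>B\<in>blocks P x. (card (B \<inter> sym_diff x y) choose 2) * (card (B \<inter> sym_diff x y) - 2))"
    using P xy by (intro packing5_triples_lower[of _ V] packing5_blocks[OF PV finV sep] blocks_subset[OF PV] finV)
      (auto simp: pair_design_code_def)
  thus ?thesis unfolding nbrs_triple_weight[OF assms] by (simp add: setdist_def)
qed

lemma nbrs_upper:
  assumes "6 \<le> setdist x y"
  shows "3 * card (nbrs P x y (setdist x y - 1)) + 12 * card (nbrs P x y (setdist x y - 3))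
      + 30 * card (nbrs P x y (setdist x y - 5)) \<le> (setdist x y choose 2) * (setdist x y - 2)"
proof -
  have "finite (blocks P x)" using finP by (simp add: blocks_def)
  hence "(\<Sum>B\<in>blocks P x. (card (B \<inter> sym_diff x y) choose 2) * (card (B \<inter> sym_diff x y) - 2))
     \<le> (card (sym_diff x y) choose 2) * (card (sym_diff x y) - 2)"
    using xy by (intro packing5_triples_upper packing5_blocks[OF PV finV sep]) (auto intro: finite_codeword)
  thus ?thesis unfolding nbrs_triple_weight[OF assms] by (simp add: setdist_def)
qed

text \<open>Inside a 10-set each of the 45 pairs lies in at most two blocks, since
  \<open>3 * 2 \<le> 8 < 3 * 3\<close>, and a block uses ten pairs. This settles the step from 8 to
  10, where the general estimates do not suffice.\<close>

lemma nbrs_distance_10: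
  assumes "setdist x y = 10"
  shows "card (nbrs P x y 5) \<le> 9"
proof -
  define S where "S = sym_diff x y"
  define \<B> where "\<B> = {B\<in>blocks P x. B \<subseteq> S}"
  have finS: "finite S" using xy finite_codeword by (simp add: S_def)
  have pack: "packing5 \<B>"
    using packing5_blocks[OF PV finV sep xy(1)] by (auto simp: packing5_def \<B>_def)
  have sub: "\<B> \<subseteq> Pow S" by (auto simp: \<B>_def)
  have deg: "card {B\<in>\<B>. T \<subseteq> B} \<le> 2" if "T \<subseteq> S" "card T = 2" for T
    using packing5_pair_degree_le[OF pack sub finS that] assms by (simp add: S_def setdist_def)
  have "10 * card \<B> = (\<Sum>T\<in>{T. T \<subseteq> S \<and> card T = 2}. card {B\<in>\<B>. T \<subseteq> B})"
    by (rule packing5_card_eq_pair_sum[OF pack sub finS])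
  also have "\<dots> \<le> (\<Sum>T\<in>{T. T \<subseteq> S \<and> card T = 2}. 2)" using deg by (intro sum_mono) auto
  also have "\<dots> = 90" using finS assms by (simp add: n_subsets S_def setdist_def choose_two)
  finally have "card \<B> \<le> 9" by simp
  moreover have "(\<lambda>z. sym_diff x z) ` nbrs P x y 5 \<subseteq> \<B>"
  proof (rule image_subsetI)
    fix z assume "z \<in> nbrs P x y 5"
    hence z: "z \<in> P" "setdist x z = 5" "setdist y z = 5" by (auto simp: nbrs_def)
    have "card (sym_diff x z \<inter> S) = card (sym_diff x z)"
      using setdist_via_neighbour[OF z(1,2)] z assms by (simp add: S_def setdist_def)
    hence "sym_diff x z \<inter> S = sym_diff x z"
      using finite_codeword[OF xy(1)] finite_codeword[OF z(1)] by (intro card_subset_eq) auto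
    thus "sym_diff x z \<in> \<B>" using z by (auto simp: \<B>_def blocks_def)
  qed
  hence "card ((\<lambda>z. sym_diff x z) ` nbrs P x y 5) \<le> card \<B>"
    using finS finite_subset[OF sub] by (intro card_mono) auto
  moreover have "inj_on (\<lambda>z. sym_diff x z) (nbrs P x y 5)" by (rule inj_onI) auto
  ultimately show ?thesis by (simp add: card_image)
qed

end

text \<open>If \<open>f\<close> preserved all distances below \<open>i\<close> but raised a distance \<open>i\<close> to \<open>k\<close>, the neighbours of
  \<open>x\<close> nearer than \<open>i\<close> to \<open>y\<close> would have to meet the \<open>k\<close>-set \<open>f x + f y\<close> in too many triples.\<close>
lemma distance_step:
  assumes P1: "pair_design_code V1 P1" and P2: "pair_design_code V2 P2"
    and f: "bij_betw f P1 P2"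
    and IH: "\<And>j x y. j < i \<Longrightarrow> x \<in> P1 \<Longrightarrow> y \<in> P1 \<Longrightarrow> setdist (f x) (f y) = j \<longleftrightarrow> setdist x y = j"
    and i: "6 \<le> i" and xy: "x \<in> P1" "y \<in> P1" "setdist x y = i"
  shows "setdist (f x) (f y) = i"
proof (rule ccontr)
  assume neq: "setdist (f x) (f y) \<noteq> i"
  define k where "k = setdist (f x) (f y)"
  have "\<not> k < i" using IH[of k x y] xy by (auto simp: k_def)
  hence ki: "i < k" using neq by (simp add: k_def)
  have fxy: "f x \<in> P2" "f y \<in> P2" using f xy by (auto simp: bij_betw_def)
  \<comment> \<open>Both distances defining these neighbours, 5 and \<open>j\<close>, are below
    \<open>i\<close> and hence preserved.\<close>
  have same: "card (nbrs P2 (f x) (f y) j) = card (nbrs P1 x y j)" if "j < i" for j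
  proof -
    have "setdist (f x) (f z) = 5 \<longleftrightarrow> setdist x z = 5" "setdist (f y) (f z) = j \<longleftrightarrow> setdist y z = j"
      if "z \<in> P1" for z using IH[of 5 x z] IH[OF \<open>j < i\<close>, of y z] that i xy by auto
    moreover have "P2 = f ` P1" using f by (simp add: bij_betw_def)
    ultimately have "nbrs P2 (f x) (f y) j = f ` nbrs P1 x y j"
      by (auto simp: nbrs_def image_iff)
    moreover have "inj_on f (nbrs P1 x y j)"
      using f by (auto simp: bij_betw_def nbrs_def inj_on_def)
    ultimately show ?thesis by (simp add: card_image)
  qed
  define a b c where "a = card (nbrs P1 x y (i - 1))" and "b = card (nbrs P1 x y (i - 3))"
    and "c = card (nbrs P1 x y (i - 5))"
  have a2: "card (nbrs P2 (f x) (f y) (i - 1)) = a" and b2: "card (nbrs P2 (f x) (f y) (i - 3)) = b"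
    and c2: "card (nbrs P2 (f x) (f y) (i - 5)) = c"
    using same i by (auto simp: a_def b_def c_def)
  have range2: "k \<le> j + 5 \<and> even (k + 5 + j)" if "card (nbrs P2 (f x) (f y) j) \<noteq> 0" for j
  proof -
    obtain z where "z \<in> nbrs P2 (f x) (f y) j" using \<open>card _ \<noteq> 0\<close> by fastforce
    thus ?thesis using nbrs_range[OF P2 fxy] by (simp add: k_def)
  qed
  have low: "(i choose 2) * (i - 3) \<le> 3 * a + 12 * b + 30 * c"
    using nbrs_lower[OF P1 xy(1,2)] i xy(3) by (simp add: a_def b_def c_def)
  hence low2: "i * (i - 1) * (i - 3) \<le> 6 * a + 24 * b + 60 * c"
    using two_times_choose_two[of i] mult_le_mono2[OF low, of 2] by (simp add: mult.assoc[symmetric])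
  \<comment> \<open>The neighbours at distance \<open>k - 1 \<ge> i\<close> are dropped, as nothing
    is known about them. The remaining counts are \<open>a\<close> and \<open>b\<close> if
    \<open>k = i + 2\<close>; the last one is \<open>a\<close> if \<open>k = i + 4\<close>.\<close>
  have up: "12 * card (nbrs P2 (f x) (f y) (k - 3)) + 30 * card (nbrs P2 (f x) (f y) (k - 5))
     \<le> (k choose 2) * (k - 2)"
    using nbrs_upper[OF P2 fxy] i ki by (simp add: k_def[symmetric])
  hence up2: "24 * card (nbrs P2 (f x) (f y) (k - 3)) + 60 * card (nbrs P2 (f x) (f y) (k - 5))
     \<le> k * (k - 1) * (k - 2)"
    using two_times_choose_two[of k] mult_le_mono2[OF up, of 2] by (simp add: mult.assoc[symmetric])
  \<comment> \<open>A neighbour counted by \<open>c\<close> would force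
    \<open>k \<le> i\<close>.\<close>
  have c0: "c = 0" using range2[of "i - 5"] c2 i ki by (cases "c = 0") auto
  \<comment> \<open>\<open>a\<close> and \<open>b\<close> can be nonzero only if \<open>k\<close>
    has the parity of \<open>i\<close> and is at most \<open>i + 4\<close>, respectively
    \<open>i + 2\<close>. For any other \<open>k\<close> nothing is left to meet the lower
    bound.\<close>
  consider "k = i + 2" | "k = i + 4" | "k \<noteq> i + 2" "k \<noteq> i + 4" by blast
  thus False
  proof cases
    case 1
    have up3: "24 * a + 60 * b \<le> (i + 2) * (i + 1) * i" using up2 a2 b2 i by (simp add: 1)
    \<comment> \<open>Here \<open>i - 3\<close> is 3 or 4, which is no distance between
      codewords.\<close>
    have small: "b = 0" if "i \<le> 7"
    proof (rule ccontr)
      assume "b \<noteq> 0"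
      then obtain z where "z \<in> nbrs P1 x y (i - 3)" unfolding b_def by fastforce
      thus False using nbrs_range(3)[OF P1 xy(1,2)] that i by fastforce
    qed
    consider "i = 6" | "i = 7" | "i = 8" | "9 \<le> i" using i by linarith
    thus False
    proof cases
      assume "i = 8"
      hence "b \<le> 9" using nbrs_distance_10[OF P2 fxy] b2 1 by (simp add: k_def)
      thus False using low2 up3 c0 \<open>i = 8\<close> by simp
    next
      assume "9 \<le> i"
      then obtain e where e: "i = 9 + e" using le_Suc_ex by blast
      \<comment> \<open>Uses \<open>5 * (6 * a + 24 * b) \<le> 2 * (24 * a + 60 * b)\<close>. After
        cancelling \<open>i\<close> the contradiction starts at 9 (240 against 220); at 8 it is 175
        against 180, hence the separate case.\<close>
      have "5 * (i * (i - 1) * (i - 3)) \<le> 2 * ((i + 2) * (i + 1) * i)" using low2 up3 c0 by linarith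
      hence "i * (5 * ((i - 1) * (i - 3))) \<le> i * (2 * ((i + 2) * (i + 1)))" by (simp only: mult_ac)
      hence "5 * ((i - 1) * (i - 3)) \<le> 2 * ((i + 2) * (i + 1))" unfolding mult_le_cancel1 using i by simp
      thus False by (simp add: e algebra_simps)
    qed (use low2 up3 c0 small in simp_all)
  next
    case 2
    have b0: "b = 0" using range2[of "i - 3"] b2 i 2 by (cases "b = 0") auto
    have "60 * a \<le> (i + 4) * (i + 3) * (i + 2)"
    proof -
      have "k - 1 = i + 3" "k - 2 = i + 2" "k - 5 = i - 1" using 2 i by auto
      thus ?thesis using up2 a2 by (simp only: 2)
    qed
    \<comment> \<open>Already false at \<open>i = 6\<close>, with 900 against 720.\<close>
    hence *: "10 * (i * (i - 1) * (i - 3)) \<le> (i + 4) * (i + 3) * (i + 2)" using low2 b0 c0 by linarith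
    obtain e where "i = 6 + e" using i le_Suc_ex by blast
    thus False using * by (simp add: algebra_simps)
  next
    case 3
    have "a = 0"
    proof (rule ccontr)
      assume "a \<noteq> 0"
      hence "k \<le> i - 1 + 5" "even (k + 5 + (i - 1))" using range2[of "i - 1"] a2 by auto
      hence "k \<le> i + 4" "even (k + i)" using i by auto
      moreover have "k \<in> {i+1, i+2, i+3, i+4}" using \<open>k \<le> i + 4\<close> ki by auto
      ultimately show False using 3 by auto
    qed
    moreover have "b = 0"
    proof (rule ccontr)
      assume "b \<noteq> 0"
      hence "k \<le> i - 3 + 5" "even (k + 5 + (i - 3))" using range2[of "i - 3"] b2 by auto
      hence "k \<le> i + 2" "even (k + i)" using i by auto
      moreover have "k \<in> {i+1, i+2}" using \<open>k \<le> i + 2\<close> ki by auto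
      ultimately show False using 3 by auto
    qed
    ultimately show False using low2 c0 i by simp
  qed
qed

text \<open>Strong induction on the distance: 0 by injectivity, 1 to 4 never occur, 5 by hypothesis.
  From 6 on, \<open>distance_step\<close> gives one implication for \<open>f\<close> and the
  converse for its inverse.\<close>

theorem distance_5_preserving_imp_isometry:
  assumes P1: "pair_design_code V1 P1" and P2: "pair_design_code V2 P2"
    and f: "bij_betw f P1 P2"
    and five: "\<And>x y. x \<in> P1 \<Longrightarrow> y \<in> P1 \<Longrightarrow> setdist (f x) (f y) = 5 \<longleftrightarrow> setdist x y = 5"
    and "x \<in> P1" "y \<in> P1"
  shows "setdist (f x) (f y) = setdist x y"
proof -
  define g where "g = inv_into P1 f"
  have g: "bij_betw g P2 P1" using f by (simp add: g_def bij_betw_inv_into)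
  have gf: "g (f z) = z" if "z \<in> P1" for z using f that by (simp add: g_def bij_betw_inv_into_left)
  have fg: "f (g z) = z" if "z \<in> P2" for z using f that by (simp add: g_def bij_betw_inv_into_right)
  have fP: "f z \<in> P2" if "z \<in> P1" for z using f that by (auto simp: bij_betw_def)
  have gP: "g z \<in> P1" if "z \<in> P2" for z using g that by (auto simp: bij_betw_def)
  have small: "setdist u v = 0 \<longleftrightarrow> u = v" "u \<noteq> v \<Longrightarrow> 5 \<le> setdist u v"
    if "pair_design_code W Q" "u \<in> Q" "v \<in> Q" for W u v and Q :: "'c set set"
  proof -
    have "finite u" "finite v" using that by (auto simp: pair_design_code_def intro: finite_subset[of _ W])
    thus "setdist u v = 0 \<longleftrightarrow> u = v" by (auto simp: setdist_def)
    show "u \<noteq> v \<Longrightarrow> 5 \<le> setdist u v" using that by (auto simp: pair_design_code_def separated_def)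
  qed
  have "setdist (f x) (f y) = i \<longleftrightarrow> setdist x y = i" if "x \<in> P1" "y \<in> P1" for i x y
    using that
  proof (induction i arbitrary: x y rule: less_induct)
    case (less i)
    have inj: "f x = f y \<longleftrightarrow> x = y" using gf less.prems by metis
    consider "i = 0" | "0 < i" "i < 5" | "i = 5" | "6 \<le> i" by linarith
    thus ?case
    proof cases
      case 1
      thus ?thesis using small(1)[OF P1 less.prems] small(1)[OF P2 fP fP, OF less.prems] inj by simp
    next
      case 2
      thus ?thesis using small[OF P1 less.prems] small[OF P2 fP fP, OF less.prems] inj by (cases "x = y") auto
    next
      case 3
      thus ?thesis using five less.prems by simp
    next
      case 4
      have "setdist (f x) (f y) = i" if "setdist x y = i"
        using distance_step[OF P1 P2 f less.IH 4 less.prems that] by blast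
      moreover have "setdist (g (f x)) (g (f y)) = i" if "setdist (f x) (f y) = i"
      proof (rule distance_step[OF P2 P1 g _ 4 fP[OF less.prems(1)] fP[OF less.prems(2)] that])
        fix j u v assume "j < i" "u \<in> P2" "v \<in> P2"
        thus "setdist (g u) (g v) = j \<longleftrightarrow> setdist u v = j"
          using less.IH[of j "g u" "g v"] gP fg by simp
      qed
      ultimately show ?thesis using gf less.prems by auto
    qed
  qed
  thus ?thesis using assms by blast
qed

section \<open>Punctured Preparata codes\<close>

definition supp :: "bool list \<Rightarrow> nat set" where
  "supp x = {i. i < length x \<and> x ! i}"

lemma hamming_eq_setdist:
  "length x = length y \<Longrightarrow> hamming x y = setdist (supp x) (supp y)"
  unfolding hamming_def setdist_def supp_def by (rule arg_cong[where f = card]) auto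

lemma inj_on_supp: "inj_on supp (binvecs n)"
proof (rule inj_onI)
  fix x y assume "x \<in> binvecs n" "y \<in> binvecs n" "supp x = supp y"
  thus "x = y" unfolding binvecs_def supp_def by (intro nth_equalityI) (auto simp: set_eq_iff)
qed

lemma supp_image_subset: "C \<subseteq> binvecs n \<Longrightarrow> supp ` C \<subseteq> Pow {..<n}"
  by (auto simp: binvecs_def supp_def)

lemma finite_binvecs: "finite (binvecs n)"
  using finite_imageD[OF _ inj_on_supp] finite_subset[OF supp_image_subset[OF subset_refl]] by auto

lemma hamming_eq_0_iff: "length x = length y \<Longrightarrow> hamming x y = 0 \<longleftrightarrow> x = y"
  unfolding hamming_def by (auto intro!: nth_equalityI)

lemma finite_code_distances:
  assumes "C \<subseteq> binvecs n"
  shows "finite {hamming x y | x y. x \<in> C \<and> y \<in> C \<and> x \<noteq> y}"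
proof -
  have "finite C" using assms finite_binvecs finite_subset by blast
  hence "finite ((\<lambda>(x, y). hamming x y) ` (C \<times> C))" by simp
  thus ?thesis by (rule finite_subset[rotated]) auto
qed

lemma code_distance_le:
  assumes "C \<subseteq> binvecs n" "x \<in> C" "y \<in> C" "x \<noteq> y"
  shows "code_distance C \<le> hamming x y"
  unfolding code_distance_def using assms by (intro Min_le finite_code_distances) auto

lemma code_distance_eqI:
  assumes "C \<subseteq> binvecs n" "x \<in> C" "y \<in> C" "x \<noteq> y" "hamming x y = d"
    and "\<And>x y. x \<in> C \<Longrightarrow> y \<in> C \<Longrightarrow> x \<noteq> y \<Longrightarrow> d \<le> hamming x y"
  shows "code_distance C = d"
  unfolding code_distance_def using assms by (intro Min_eqI finite_code_distances) auto

lemma length_delete_coord: "i < length x \<Longrightarrow> length (delete_coord i x) = length x - 1"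
  by (simp add: delete_coord_def)

lemma nth_delete_coord:
  "i < length x \<Longrightarrow> j < length x - 1 \<Longrightarrow> delete_coord i x ! j = x ! (if j < i then j else Suc j)"
  by (auto simp: delete_coord_def nth_append)

lemma hamming_delete_coord:
  assumes "length x = N" "length y = N" "i < N"
  shows "hamming x y \<le> hamming (delete_coord i x) (delete_coord i y) + 1"
    and "hamming (delete_coord i x) (delete_coord i y) \<le> hamming x y"
proof -
  \<comment> \<open>The original position of the \<open>j\<close>-th coordinate that survives the
    deletion.\<close>
  define s where "s = (\<lambda>j. if j < i then j else Suc j)"
  define D where "D = {j. j < N \<and> x ! j \<noteq> y ! j}"
  define D' where "D' = {j. j < N - 1 \<and> x ! s j \<noteq> y ! s j}"
  have inj: "inj_on s D'" by (auto simp: inj_on_def s_def split: if_splits)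
  have "s ` D' = D - {i}"
  proof
    show "s ` D' \<subseteq> D - {i}" using assms by (auto simp: s_def D_def D'_def)
    show "D - {i} \<subseteq> s ` D'"
    proof
      fix k assume k: "k \<in> D - {i}"
      define j where "j = (if k < i then k else k - 1)"
      have "k = s j" using k by (auto simp: s_def j_def)
      moreover have "j < N - 1" using k assms(3) by (auto simp: j_def D_def)
      ultimately show "k \<in> s ` D'" using k by (auto simp: D_def D'_def)
    qed
  qed
  hence card: "card D' = card (D - {i})" using card_image[OF inj] by simp
  have D: "hamming x y = card D" using assms by (simp add: hamming_def D_def)
  have D': "hamming (delete_coord i x) (delete_coord i y) = card D'"
    using assms by (simp add: hamming_def D'_def s_def length_delete_coord nth_delete_coord cong: conj_cong)
  have finD: "finite D" by (simp add: D_def)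
  show "hamming (delete_coord i x) (delete_coord i y) \<le> hamming x y"
    unfolding D D' card using finD by (intro card_mono) auto
  show "hamming x y \<le> hamming (delete_coord i x) (delete_coord i y) + 1"
    unfolding D D' card using card_Suc_Diff1[OF finD, of i] by (cases "i \<in> D") simp_all
qed

text \<open>Powers of 4 are 1 modulo 3. This supplies the divisibility of the punctured length asked
  for in \<open>johnson_equality_design\<close>.\<close>

lemma three_dvd_two_power_minus_one:
  assumes "even m"
  shows "(3::nat) dvd 2 ^ m - 1"
proof -
  obtain k where "m = 2 * k" using assms by (elim evenE)
  moreover have "(4::nat) ^ k mod 3 = 1" by (induction k) (auto simp: mod_mult_right_eq[symmetric, of 4])
  ultimately show ?thesis by (simp add: power_mult mod_eq_dvd_iff_nat[symmetric])
qed

section \<open>Puncturing any code of Preparata size and distance at least 6\<close>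

context
  fixes m i :: nat and C :: "bool list set"
  assumes m: "4 \<le> m" "even m" and C: "C \<subseteq> binvecs (2 ^ m)" and i: "i < 2 ^ m"
    and dist: "\<And>x y. x \<in> C \<Longrightarrow> y \<in> C \<Longrightarrow> x \<noteq> y \<Longrightarrow> 6 \<le> hamming x y"
    and big: "2 ^ (2 ^ m) \<le> card C * (2 ^ m)\<^sup>2"
begin

private lemma len: "x \<in> C \<Longrightarrow> length x = 2 ^ m"
  using C by (auto simp: binvecs_def)

lemma punctured_is_code: "delete_coord i ` C \<subseteq> binvecs (2 ^ m - 1)"
  using len i by (auto simp: binvecs_def length_delete_coord)

lemma punctured_distance_ge:
  assumes "x \<in> C" "y \<in> C" "x \<noteq> y"
  shows "5 \<le> hamming (delete_coord i x) (delete_coord i y)"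
  using dist[OF assms] hamming_delete_coord(1)[OF len[OF assms(1)] len[OF assms(2)] i] by simp

lemma inj_on_delete_coord: "inj_on (delete_coord i) C"
proof (rule inj_onI)
  fix x y assume "x \<in> C" "y \<in> C" "delete_coord i x = delete_coord i y"
  thus "x = y" using punctured_distance_ge[of x y] by (cases "x = y") (auto simp: hamming_def)
qed

text \<open>Puncturing loses no codeword and at most one from each distance; with
  \<open>n + 1 = 2 ^ m\<close> the size hypothesis is the one of the Johnson bound.\<close>

lemma punctured_pair_design_code:
  "pair_design_code {..<2 ^ m - 1} (supp ` delete_coord i ` C)"
proof -
  define P where "P = supp ` delete_coord i ` C"
  have PV: "P \<subseteq> Pow {..<2 ^ m - 1}"
    unfolding P_def by (rule supp_image_subset[OF punctured_is_code])
  have sep: "separated 5 P"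
    unfolding separated_def P_def
  proof (clarify)
    fix x y assume xy: "x \<in> C" "y \<in> C" "supp (delete_coord i x) \<noteq> supp (delete_coord i y)"
    have "hamming (delete_coord i x) (delete_coord i y)
      = setdist (supp (delete_coord i x)) (supp (delete_coord i y))"
      using xy len i by (intro hamming_eq_setdist) (simp add: length_delete_coord)
    thus "5 \<le> setdist (supp (delete_coord i x)) (supp (delete_coord i y))"
      using punctured_distance_ge[of x y] xy by auto
  qed
  have "card P = card C"
    unfolding P_def
    using card_image[OF inj_on_subset[OF inj_on_supp punctured_is_code]] card_image[OF inj_on_delete_coord]
    by simp
  hence "2 ^ (card {..<2 ^ m - 1 :: nat} + 1) \<le> card P * (card {..<2 ^ m - 1 :: nat} + 1)\<^sup>2"
    using big by simp
  thus ?thesis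
    unfolding pair_design_code_def P_def[symmetric] using PV sep three_dvd_two_power_minus_one[OF m(2)]
    by (intro conjI ballI allI impI johnson_equality_design) simp_all
qed

text \<open>The pair of coordinates 0 and 1 has degree \<open>(2 ^ m - 4) / 3\<close>, which is
  positive, so some block, and with it a neighbour, exists.\<close>

lemma punctured_distance_5_attained:
  "\<exists>x\<in>C. \<exists>y\<in>C. x \<noteq> y \<and> hamming (delete_coord i x) (delete_coord i y) = 5"
proof -
  have "(2::nat) ^ 4 \<le> 2 ^ m" using m(1) by (intro power_increasing) auto
  hence m16: "(16::nat) \<le> 2 ^ m" by simp
  have "C \<noteq> {}" using big by auto
  then obtain x where x: "x \<in> C" by blast
  define P where "P = supp ` delete_coord i ` C"
  define c where "c = supp (delete_coord i x)"
  have "c \<in> P" using x by (auto simp: c_def P_def)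
  hence "3 * card {B\<in>blocks P c. {0, 1} \<subseteq> B} = 2 ^ m - 1 - 3"
    using punctured_pair_design_code m16 unfolding pair_design_code_def P_def[symmetric]
    by (auto dest!: bspec[of _ _ c] spec[of _ "{0, 1::nat}"])
  hence "card {B\<in>blocks P c. {0, 1} \<subseteq> B} \<noteq> 0" using m16 by auto
  then obtain B where "B \<in> blocks P c" by fastforce
  then obtain y where y: "y \<in> C" "setdist c (supp (delete_coord i y)) = 5"
    by (auto simp: blocks_def P_def)
  hence "hamming (delete_coord i x) (delete_coord i y) = 5"
    using x len i hamming_eq_setdist[of "delete_coord i x" "delete_coord i y"]
    by (simp add: c_def length_delete_coord)
  moreover have "x \<noteq> y" using y by (auto simp: c_def setdist_def)
  ultimately show ?thesis using x y by blast
qed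

lemma punctured_code_distance: "code_distance (delete_coord i ` C) = 5"
proof -
  obtain x y where xy: "x \<in> C" "y \<in> C" "x \<noteq> y" "hamming (delete_coord i x) (delete_coord i y) = 5"
    using punctured_distance_5_attained by blast
  show ?thesis
  proof (rule code_distance_eqI[OF punctured_is_code _ _ _ xy(4)])
    show "delete_coord i x \<noteq> delete_coord i y" using xy(1-3) inj_on_delete_coord by (auto simp: inj_on_def)
  qed (use xy punctured_distance_ge in auto)
qed

text \<open>A pair at distance 5 after puncturing was at distance at most 6 before, so the lower
  bound 6 is attained.\<close>

lemma code_distance_6: "has_min_dist C 6"
proof -
  obtain x y where xy: "x \<in> C" "y \<in> C" "x \<noteq> y" "hamming (delete_coord i x) (delete_coord i y) = 5"
    using punctured_distance_5_attained by blast
  have "hamming x y = 6"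
    using dist[OF xy(1-3)] hamming_delete_coord(1)[OF len[OF xy(1)] len[OF xy(2)] i] xy(4) by simp
  hence "code_distance C = 6" using xy dist by (intro code_distance_eqI[OF C]) auto
  moreover have "finite C" using C finite_binvecs finite_subset by blast
  hence "card {x, y} \<le> card C" using xy by (intro card_mono) auto
  ultimately show ?thesis using xy(3) by (simp add: has_min_dist_def)
qed

end

lemma preparata_type_code_exists:
  assumes m: "4 \<le> m" "even m"
  shows "\<exists>D. is_code (2 ^ m) D \<and> has_min_dist D 6 \<and> 2 ^ (2 ^ m) \<le> card D * (2 ^ m)\<^sup>2"
proof -
  obtain V :: "(bit alg_closure \<times> bool) set" and P where V: "finite V" "card V = 2 ^ m"
    and P: "P \<subseteq> Pow V" "separated 6 P" and big: "2 ^ card V \<le> card P * (card V)\<^sup>2"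
    \<comment> \<open>For even \<open>m\<close> the exponent \<open>m - 1\<close> is odd, as the
      field construction requires.\<close>
    using separated_6_code_exists[of "m - 1"] m by auto
  obtain g where g: "bij_betw g {..<2 ^ m :: nat} V"
    using finite_same_card_bij[of "{..<2 ^ m :: nat}" V] V by auto
  define w where "w = (\<lambda>S. map (\<lambda>i. g i \<in> S) [0..<2 ^ m])"
  have len: "length (w S) = 2 ^ m" for S by (simp add: w_def)
  have ham: "hamming (w S) (w S') = setdist S S'" if "S \<in> P" "S' \<in> P" for S S'
  proof -
    have "g ` {i. i < 2 ^ m \<and> (g i \<in> S) \<noteq> (g i \<in> S')} = sym_diff S S'"
      using g that P by (fastforce simp: bij_betw_def)
    moreover have "inj_on g {i. i < 2 ^ m \<and> (g i \<in> S) \<noteq> (g i \<in> S')}"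
      using g by (auto simp: bij_betw_def inj_on_def)
    ultimately have "setdist S S' = card {i. i < 2 ^ m \<and> (g i \<in> S) \<noteq> (g i \<in> S')}"
      unfolding setdist_def using card_image by fastforce
    also have "\<dots> = hamming (w S) (w S')"
      unfolding hamming_def len by (rule arg_cong[where f = card]) (auto simp: w_def)
    finally show ?thesis ..
  qed
  have inj: "inj_on w P"
  proof (rule inj_onI)
    fix S S' assume S: "S \<in> P" "S' \<in> P" "w S = w S'"
    hence "setdist S S' = 0" using ham[of S S'] by (simp add: hamming_def)
    hence "\<not> 6 \<le> setdist S S'" by simp
    thus "S = S'" using S P(2) unfolding separated_def by blast
  qed
  have D: "w ` P \<subseteq> binvecs (2 ^ m)" using len by (auto simp: binvecs_def)
  have big': "2 ^ (2 ^ m) \<le> card (w ` P) * (2 ^ m)\<^sup>2" using big V card_image[OF inj] by simp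
  have "has_min_dist (w ` P) 6"
    using ham P(2) by (intro code_distance_6[OF m D _ _ big', of 0]) (fastforce simp: separated_def)+
  thus ?thesis using D big' by (auto simp: is_code_def)
qed

text \<open>Maximality against the code of \<open>preparata_type_code_exists\<close> gives every
  Preparata code the size needed above. The cardinality comparison, used both ways, shows that codes
  of equal length have equal size.\<close>

lemma punctured_preparata_properties:
  assumes "punctured_preparata n P"
  shows "P \<subseteq> binvecs n" "code_distance P = 5" "pair_design_code {..<n} (supp ` P)"
    and "punctured_preparata n Q \<Longrightarrow> card Q \<le> card P"
proof -
  obtain m C i where m: "4 \<le> m" "even m" and i: "i < 2 ^ m" and n: "n = 2 ^ m - 1"
    and P: "P = delete_coord i ` C" and C: "C \<subseteq> binvecs (2 ^ m)" "code_distance C = 6"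
    and max: "\<And>D. is_code (2 ^ m) D \<Longrightarrow> has_min_dist D 6 \<Longrightarrow> card D \<le> card C"
    using assms by (auto simp: punctured_preparata_def preparata_code_def is_code_def has_min_dist_def)
  have dist: "6 \<le> hamming x y" if "x \<in> C" "y \<in> C" "x \<noteq> y" for x y
    using code_distance_le[OF C(1) that] C(2) by simp
  obtain D where D: "is_code (2 ^ m) D" "has_min_dist D 6" "2 ^ (2 ^ m) \<le> card D * (2 ^ m)\<^sup>2"
    using preparata_type_code_exists[OF m] by blast
  have big: "2 ^ (2 ^ m) \<le> card C * (2 ^ m)\<^sup>2"
    using D(3) mult_le_mono1[OF max[OF D(1,2)], of "(2 ^ m)\<^sup>2"] by linarith
  note facts = m C(1) i dist big
  show "P \<subseteq> binvecs n" unfolding P n by (rule punctured_is_code[OF facts])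
  show "code_distance P = 5" unfolding P by (rule punctured_code_distance[OF facts])
  show "pair_design_code {..<n} (supp ` P)" unfolding P n by (rule punctured_pair_design_code[OF facts])
  have cardP: "card P = card C" unfolding P by (rule card_image[OF inj_on_delete_coord[OF facts]])
  show "card Q \<le> card P" if Q_prep: "punctured_preparata n Q"
  proof -
    obtain m' C' i' where Q: "preparata_code m' C'" "n = 2 ^ m' - 1" "Q = delete_coord i' ` C'"
      using Q_prep unfolding punctured_preparata_def by blast
    have "(2::nat) ^ m' = 2 ^ m"
      using Q(2) n by (metis Suc_diff_1 pos2 zero_less_power)
    hence "m' = m" by simp
    hence "card C' \<le> card C" using Q(1) max by (auto simp: preparata_code_def)
    moreover have "finite C'"
      using Q(1) finite_binvecs finite_subset by (auto simp: preparata_code_def is_code_def)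
    hence "card Q \<le> card C'" unfolding Q(3) by (rule card_image_le)
    ultimately show ?thesis using cardP by simp
  qed
qed

theorem theorem1:
  assumes "punctured_preparata n P1" and "punctured_preparata n P2"
  shows "md_graphs_isomorphic P1 P2 \<longleftrightarrow> isometric P1 P2"
proof
  note P1 = punctured_preparata_properties[OF assms(1)] and P2 = punctured_preparata_properties[OF assms(2)]
  have ham1: "hamming x y = setdist (supp x) (supp y)" if "x \<in> P1" "y \<in> P1" for x y
    using that P1(1) by (intro hamming_eq_setdist) (auto simp: binvecs_def)
  have ham2: "hamming x y = setdist (supp x) (supp y)" if "x \<in> P2" "y \<in> P2" for x y
    using that P2(1) by (intro hamming_eq_setdist) (auto simp: binvecs_def)
  have inj: "inj_on supp P1" "inj_on supp P2" using inj_on_supp P1(1) P2(1) inj_on_subset by blast+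
  {
    assume "md_graphs_isomorphic P1 P2"
    then obtain f where f: "bij_betw f P1 P2"
      and adj: "\<And>x y. x \<in> P1 \<Longrightarrow> y \<in> P1 \<Longrightarrow> md_adj P1 x y \<longleftrightarrow> md_adj P2 (f x) (f y)"
      by (auto simp: md_graphs_isomorphic_def)
    have fP: "f x \<in> P2" if "x \<in> P1" for x using f that by (auto simp: bij_betw_def)
    \<comment> \<open>The graph isomorphism transported to supports.\<close>
    define F where "F = supp \<circ> f \<circ> inv_into P1 supp"
    have F: "F (supp x) = supp (f x)" if "x \<in> P1" for x using that inj by (simp add: F_def)
    have "bij_betw (inv_into P1 supp) (supp ` P1) P1"
      by (rule bij_betw_inv_into[OF inj_on_imp_bij_betw[OF inj(1)]])
    hence bij: "bij_betw F (supp ` P1) (supp ` P2)"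
      unfolding F_def comp_assoc by (rule bij_betw_trans[OF bij_betw_trans[OF _ f] inj_on_imp_bij_betw[OF inj(2)]])
    have five: "setdist (F x) (F y) = 5 \<longleftrightarrow> setdist x y = 5" if xy: "x \<in> supp ` P1" "y \<in> supp ` P1" for x y
    proof -
      obtain u v where uv: "u \<in> P1" "v \<in> P1" "x = supp u" "y = supp v" using xy by blast
      thus ?thesis using adj[of u v] fP P1(2) P2(2) by (auto simp: md_adj_def F ham1 ham2)
    qed
    have "hamming (f x) (f y) = hamming x y" if "x \<in> P1" "y \<in> P1" for x y
      using distance_5_preserving_imp_isometry[OF P1(3) P2(3) bij five, of "supp x" "supp y"] that fP
      by (simp add: F ham1 ham2)
    thus "isometric P1 P2" unfolding isometric_def using fP by blast
  next
    assume "isometric P1 P2"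
    then obtain I where I: "\<And>x. x \<in> P1 \<Longrightarrow> I x \<in> P2"
      "\<And>x y. x \<in> P1 \<Longrightarrow> y \<in> P1 \<Longrightarrow> hamming (I x) (I y) = hamming x y"
      by (auto simp: isometric_def)
    have fin2: "finite P2" using P2(1) finite_binvecs finite_subset by blast
    have "inj_on I P1"
    proof (rule inj_onI)
      fix x y assume xy: "x \<in> P1" "y \<in> P1" "I x = I y"
      hence "hamming x y = 0" using I(2)[of x y] by (simp add: hamming_def)
      thus "x = y" using xy P1(1) hamming_eq_0_iff[of x y] by (auto simp: binvecs_def)
    qed
    \<comment> \<open>The given isometry only maps into \<open>P2\<close>; injectivity and equal
      size make it onto. Adjacency means distance 5 in both codes, so it is preserved.\<close>
    moreover have "card P1 = card P2" using P1(4)[OF assms(2)] P2(4)[OF assms(1)] by simp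
    ultimately have "bij_betw I P1 P2"
      using I(1) fin2 card_subset_eq[of P2 "I ` P1"] unfolding bij_betw_def by (auto simp: card_image)
    moreover have "md_adj P1 x y \<longleftrightarrow> md_adj P2 (I x) (I y)" if "x \<in> P1" "y \<in> P1" for x y
      using I that P1(2) P2(2) by (simp add: md_adj_def)
    ultimately show "md_graphs_isomorphic P1 P2" unfolding md_graphs_isomorphic_def by blast
  }
qed

end
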